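(* Let $1<p<\infty$, $p'=p/(p-1)$, and let $u,v$ be arbitrary weights on $\mathbb{R}^n$. Then $$\sup_{\mathscr{D},\mathcal{S}}\|\mathcal{A}_{\mathscr{D},\mathcal{S}}\|_{L^p(v)\to L^p(u)}\asymp\|\mathcal{M}\|_{L^p(v)\times L^{p'}(u^{1-p'})\to L^1},$$ i.e. each side is bounded by a constant depending only on $n$ times the other side. Here the supremum is over all general dyadic grids $\mathscr{D}$ and all sparse families $\mathcal{S}\subset\mathscr{D}$.
   Context: A weight is a non-negative locally integrable function on $\mathbb{R}^n$; $\|f\|_{L^p(w)}=(\int|f|^pw\,dx)^{1/p}$. The operator norms are the best constants in $[0,\infty]$: the least $C$ with $\|\mathcal{A}_{\mathscr{D},\mathcal{S}}f\|_{L^p(u)}\le C\|f\|_{L^p(v)}$, and the least $C$ with $\|\mathcal{M}(f,g)\|_{L^1}\le C\|f\|_{L^p(v)}\|g\|_{L^{p'}(u^{1-p'})}$ (for these operators it suffices to consider non-negative $f,g$). The bi(sub)linear maximal operator is $$\mathcal{M}(f,g)(x)=\sup_{Q\ni x}\Big(\frac1{|Q|}\int_Q|f|\Big)\Big(\frac1{|Q|}\int_Q|g|\Big),$$ the supremum being over all cubes $Q\subset\mathbb{R}^n$ containing $x$. General dyadic grid $\mathscr{D}$: a collection of cubes in $\mathbb{R}^n$ such that (i) every $Q\in\mathscr{D}$ has sidelength $\ell_Q=2^k$ for some $k\in\mathbb{Z}$; (ii) $Q\cap R\in\{Q,R,\emptyset\}$ for all $Q,R\in\mathscr{D}$; (iii)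 the cubes of each fixed sidelength $2^k$ form a partition of $\mathbb{R}^n$. Sparse family $\mathcal{S}=\{Q_j^k\}\subset\mathscr{D}$ (the level $k$ runs over a finite or infinite interval of consecutive integers): (i) for fixed $k$ the cubes $Q_j^k$ are pairwise disjoint in $j$; (ii) with $\Omega_k=\bigcup_jQ_j^k$, $\Omega_{k+1}\subset\Omega_k$; (iii) $|\Omega_{k+1}\cap Q_j^k|\le\frac12|Q_j^k|$. $\mathcal{A}_{\mathscr{D},\mathcal{S}}f(x)=\sum_{j,k}f_{Q_j^k}\chi_{Q_j^k}(x)$, where $f_Q=\frac1{|Q|}\int_Qf$. *)

theory Defs
  imports "HOL-Analysis.Analysis"
begin

text \<open>
  Integrals of non-negative quantities are taken in \<open>ennreal\<close>, with the usual measure-theoretic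
  convention \<open>0 * \<infinity> = 0\<close>, and all measurability is with respect to Lebesgue measure.
\<close>

text \<open>
  Real powers on \<open>[0,\<infinity>]\<close>, with \<open>0\<close> raised to a negative exponent equal to \<open>\<infinity>\<close>.
  The real function \<open>powr\<close> satisfies \<open>0 powr a = 0\<close> for every \<open>a\<close>, which would give the
  wrong value to the dual weight \<open>u\<^bsup>1-p'\<^esup>\<close> where \<open>u\<close> vanishes.
\<close>

definition epowr :: "ennreal \<Rightarrow> real \<Rightarrow> ennreal" where
  "epowr x a =
    (if a = 0 then 1
     else if x = 0 then (if a > 0 then 0 else \<infinity>)
     else if x = \<infinity> then (if a > 0 then \<infinity> else 0)
     else ennreal (enn2real x powr a))"

definition weight :: "(real^'n::finite \<Rightarrow> real) \<Rightarrow> bool" where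
  "weight w \<longleftrightarrow> (\<forall>x. 0 \<le> w x) \<and> (\<forall>K. compact K \<longrightarrow> w absolutely_integrable_on K)"

text \<open>The norm in \<open>L\<^sup>p(w)\<close> of a \<open>[0,\<infinity>]\<close>-valued function; for real \<open>f\<close> it is applied to \<open>\<bar>f\<bar>\<close>.\<close>

definition Lp_norm :: "real \<Rightarrow> (real^'n::finite \<Rightarrow> ennreal) \<Rightarrow> (real^'n \<Rightarrow> ennreal) \<Rightarrow> ennreal" where
  "Lp_norm p w h = epowr (\<integral>\<^sup>+x. epowr (h x) p * w x \<partial>lebesgue) (1 / p)"

text \<open>
  An axis-parallel cube of sidelength \<open>l\<close> is a product of bounded intervals of length \<open>l\<close>.
  Each interval may be open, closed or half-open: dyadic grids need half-open cubes in order to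
  partition the space.
\<close>

definition cube_of_side :: "real \<Rightarrow> (real^'n::finite) set \<Rightarrow> bool" where
  "cube_of_side l Q \<longleftrightarrow> l > 0 \<and>
    (\<exists>(a :: real^'n) (I :: 'n \<Rightarrow> real set).
      (\<forall>i. {a $ i <..< a $ i + l} \<subseteq> I i \<and> I i \<subseteq> {a $ i .. a $ i + l}) \<and>
      Q = {x. \<forall>i. x $ i \<in> I i})"

definition cube :: "(real^'n::finite) set \<Rightarrow> bool" where
  "cube Q \<longleftrightarrow> (\<exists>l. cube_of_side l Q)"

definition average :: "(real^'n::finite) set \<Rightarrow> (real^'n \<Rightarrow> ennreal) \<Rightarrow> ennreal" where
  "average Q h = (\<integral>\<^sup>+x\<in>Q. h x \<partial>lebesgue) / emeasure lebesgue Q"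

definition bilinear_maximal ::
    "(real^'n::finite \<Rightarrow> real) \<Rightarrow> (real^'n \<Rightarrow> real) \<Rightarrow> real^'n \<Rightarrow> ennreal" where
  "bilinear_maximal f g x =
    (SUP Q \<in> {Q. cube Q \<and> x \<in> Q}.
      average Q (\<lambda>y. ennreal \<bar>f y\<bar>) * average Q (\<lambda>y. ennreal \<bar>g y\<bar>))"

definition dyadic_grid :: "(real^'n::finite) set set \<Rightarrow> bool" where
  "dyadic_grid D \<longleftrightarrow>
    (\<forall>Q\<in>D. \<exists>k::int. cube_of_side (2 powi k) Q) \<and>
    (\<forall>Q\<in>D. \<forall>R\<in>D. Q \<inter> R \<in> {Q, R, {}}) \<and>
    (\<forall>k::int. partition_on UNIV {Q \<in> D. cube_of_side (2 powi k) Q})"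

text \<open>
  A sparse family is given by its set \<open>K\<close> of levels, an interval of integers, and for each level
  \<open>k \<in> K\<close> the set \<open>S k\<close> of the cubes \<open>Q\<^sub>j\<^sup>k\<close>.
\<close>

definition sparse_family ::
    "(real^'n::finite) set set \<Rightarrow> int set \<Rightarrow> (int \<Rightarrow> (real^'n) set set) \<Rightarrow> bool" where
  "sparse_family D K S \<longleftrightarrow>
    (\<forall>i\<in>K. \<forall>j\<in>K. {i..j} \<subseteq> K) \<and>
    (\<forall>k\<in>K. S k \<subseteq> D \<and> disjoint (S k)) \<and>
    (\<forall>k. k \<in> K \<and> k + 1 \<in> K \<longrightarrow>
      \<Union>(S (k + 1)) \<subseteq> \<Union>(S k) \<and>
      (\<forall>Q \<in> S k. emeasure lebesgue (\<Union>(S (k + 1)) \<inter> Q) \<le> emeasure lebesgue Q / 2))"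

text \<open>The operator on non-negative functions \<open>f\<close>.\<close>

definition sparse_op ::
    "int set \<Rightarrow> (int \<Rightarrow> (real^'n::finite) set set) \<Rightarrow> (real^'n \<Rightarrow> real) \<Rightarrow> real^'n \<Rightarrow> ennreal" where
  "sparse_op K S f x =
    (\<Sum>\<^sub>\<infinity>(k, Q) \<in> (SIGMA k:K. S k). average Q (\<lambda>y. ennreal (f y)) * indicator Q x)"

text \<open>
  Best constants in \<open>[0,\<infinity>]\<close>. Only \<open>f\<close> and \<open>g\<close> of finite norm are tested, so that the product of
  norms on the right-hand side is never of the form \<open>0 * \<infinity>\<close>; if no constant works, the infimum
  of the empty set is \<open>\<infinity>\<close>.
\<close>

definition sparse_op_norm ::
    "real \<Rightarrow> (real^'n::finite \<Rightarrow> real) \<Rightarrow> (real^'n \<Rightarrow> real) \<Rightarrow>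
      int set \<Rightarrow> (int \<Rightarrow> (real^'n) set set) \<Rightarrow> ennreal" where
  "sparse_op_norm p v u K S = Inf {C :: ennreal.
    \<forall>f \<in> borel_measurable lebesgue.
      (\<forall>x. 0 \<le> f x) \<and> Lp_norm p (\<lambda>x. ennreal (v x)) (\<lambda>x. ennreal (f x)) < \<infinity> \<longrightarrow>
      Lp_norm p (\<lambda>x. ennreal (u x)) (sparse_op K S f)
        \<le> C * Lp_norm p (\<lambda>x. ennreal (v x)) (\<lambda>x. ennreal (f x))}"

definition bilinear_maximal_norm ::
    "real \<Rightarrow> (real^'n::finite \<Rightarrow> real) \<Rightarrow> real \<Rightarrow> (real^'n \<Rightarrow> real) \<Rightarrow> ennreal" where
  "bilinear_maximal_norm p v p' u = Inf {C :: ennreal.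
    \<forall>f \<in> borel_measurable lebesgue. \<forall>g \<in> borel_measurable lebesgue.
      Lp_norm p (\<lambda>x. ennreal (v x)) (\<lambda>x. ennreal \<bar>f x\<bar>) < \<infinity> \<and>
      Lp_norm p' (\<lambda>x. epowr (ennreal (u x)) (1 - p')) (\<lambda>x. ennreal \<bar>g x\<bar>) < \<infinity> \<longrightarrow>
      (\<integral>\<^sup>+x. bilinear_maximal f g x \<partial>lebesgue)
        \<le> C * (Lp_norm p (\<lambda>x. ennreal (v x)) (\<lambda>x. ennreal \<bar>f x\<bar>) *
               Lp_norm p' (\<lambda>x. epowr (ennreal (u x)) (1 - p')) (\<lambda>x. ennreal \<bar>g x\<bar>))}"

end

theory Submission
  imports Defs
begin

text \<open>
  Sparse by maximal: the form \<open>\<integral> (A f) g\<close> is the sum of \<open>f\<^sub>Q g\<^sub>Q |Q|\<close> over the sparse cubes. Replacing each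
  \<open>Q = Q\<^sub>j\<^sup>k\<close> by the part of \<open>Q\<close> outside the next level \<open>\<Omega>\<^sub>k\<^sub>+\<^sub>1\<close> costs a factor 2 and makes the sets
  disjoint, so the form is at most \<open>2 \<integral> M(f,g)\<close>, and duality gives the norm of \<open>A f\<close>.

  Maximal by sparse: by the one-third trick, \<open>M(f,g)\<close> is dominated by the dyadic maximal functions
  of \<open>2\<^sup>n\<close> shifted grids. For bounded \<open>f, g\<close> of bounded support and a fixed grid, the maximal cubes
  with \<open>f\<^sub>Q g\<^sub>Q > a\<^sup>k\<close>, \<open>a = 4\<^sup>n\<^sup>+\<^sup>1\<close>, form a sparse family, and the dyadic maximal function is at most
  \<open>a\<close> times the sum of \<open>f\<^sub>Q g\<^sub>Q\<close> over these cubes; its integral is thus bounded by \<open>a \<integral> (A f) g\<close>, to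
  which Hoelder's inequality applies.
\<close>

section \<open>Powers and weights\<close>

text \<open>The ratio a = 4^(n+1) comes from Cauchy-Schwarz. Let Q be maximal for a^k and let R run
  over the maximal cubes for a^(k+1) inside Q. Then a^((k+1)/2) times the sum of |R| is at most the
  sum of (int_R f int_R g)^(1/2), hence at most (int_Q f int_Q g)^(1/2) <= (4^n a^k)^(1/2) |Q|. Here
  4^n is the price of bounding the integrals over Q by those over its parent, where the product of
  averages is at most a^k. So the sum of |R| is at most (4^n/a)^(1/2) |Q| = |Q|/2. Arbitrary weights
  cause two difficulties. A function in L^p(v) need not be locally integrable, so averages may be
  infinite and maximal cubes may not exist; truncating in height and in support, with monotone
  convergence afterwards, repairs both. The weight u may vanish, where the dual weight is infinite;
  Hoelder's inequality and duality are therefore proved in [0,\<infinity>] with 0 * \<infinity> = 0.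
  The sparse family that is constructed depends on f, g and the truncation. Only a bound uniform
  over sparse families can be applied to it, which is what the supremum provides.\<close>

lemma infsum_eq_nn_integral_count_space:
  fixes f :: "'a \<Rightarrow> ennreal"
  assumes "countable A"
  shows "(\<Sum>\<^sub>\<infinity>x\<in>A. f x) = (\<integral>\<^sup>+x. f x \<partial>count_space A)"
proof (rule antisym)
  have *: "(\<Sum>\<^sub>\<infinity>x\<in>A. f x) = (SUP F\<in>{F. finite F \<and> F \<subseteq> A}. sum f F)"
    by (rule nonneg_infsum_complete) auto
  show "(\<Sum>\<^sub>\<infinity>x\<in>A. f x) \<le> (\<integral>\<^sup>+x. f x \<partial>count_space A)"
    unfolding *
  proof (rule SUP_least)
    fix F assume F: "F \<in> {F. finite F \<and> F \<subseteq> A}"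
    then have "sum f F = sum (\<lambda>x. f x * indicator F x) F"
      by (intro sum.cong) auto
    also have "\<dots> = (\<integral>\<^sup>+x. f x * indicator F x \<partial>count_space A)"
      using F by (intro nn_integral_count_space'[symmetric]) auto
    also have "\<dots> \<le> (\<integral>\<^sup>+x. f x \<partial>count_space A)"
      by (intro nn_integral_mono) (auto split: split_indicator)
    finally show "sum f F \<le> (\<integral>\<^sup>+x. f x \<partial>count_space A)" .
  qed
  show "(\<integral>\<^sup>+x. f x \<partial>count_space A) \<le> (\<Sum>\<^sub>\<infinity>x\<in>A. f x)"
  proof (cases "finite A")
    case True
    then show ?thesis by (simp add: nn_integral_count_space_finite)
  next
    case False
    note bij = bij_betw_from_nat_into[OF assms False]
    have "(\<integral>\<^sup>+x. f x \<partial>count_space A) = (\<Sum>n. f (from_nat_into A n))"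
      by (simp add: nn_integral_bij_count_space[symmetric, OF bij] nn_integral_count_space_nat)
    also have "\<dots> = (SUP n. \<Sum>i<n. f (from_nat_into A i))"
      by (rule suminf_eq_SUP)
    also have "\<dots> \<le> (\<Sum>\<^sub>\<infinity>x\<in>A. f x)"
    proof (rule SUP_least)
      fix n
      have inj: "inj_on (from_nat_into A) {..<n}"
        using bij by (auto simp: bij_betw_def intro: inj_on_subset)
      have "(\<Sum>i<n. f (from_nat_into A i)) = sum f (from_nat_into A ` {..<n})"
        by (simp add: sum.reindex[OF inj])
      also have "\<dots> \<le> (\<Sum>\<^sub>\<infinity>x\<in>A. f x)"
        unfolding * using False
        by (intro SUP_upper) (auto intro!: from_nat_into)
      finally show "(\<Sum>i<n. f (from_nat_into A i)) \<le> (\<Sum>\<^sub>\<infinity>x\<in>A. f x)" .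
    qed
    finally show ?thesis .
  qed
qed

lemma epowr_ennreal: "0 < a \<Longrightarrow> 0 \<le> x \<Longrightarrow> epowr (ennreal x) a = ennreal (x powr a)"
  by (cases "x = 0") (auto simp: epowr_def)

lemma epowr_top: "0 < a \<Longrightarrow> epowr \<infinity> a = \<infinity>"
  by (auto simp: epowr_def)

lemma epowr_zero: "0 < a \<Longrightarrow> epowr 0 a = 0"
  by (auto simp: epowr_def)

lemma epowr_mono:
  assumes "0 < a" "x \<le> y"
  shows "epowr x a \<le> epowr y a"
proof (cases y)
  case (real r)
  then have "x < top"
    using assms by (simp add: le_less_trans)
  then obtain s where "0 \<le> s" "x = ennreal s"
    by (cases x) auto
  then show ?thesis
    using assms real by (simp add: epowr_ennreal powr_mono2)
next
  case top
  then show ?thesis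
    using assms by (simp add: epowr_top[unfolded infinity_ennreal_def])
qed

lemma epowr_inverse:
  assumes "0 < a"
  shows "epowr (epowr x a) (1 / a) = x" "epowr (epowr x (1 / a)) a = x"
  using assms epowr_top[of a] epowr_top[of "1 / a"]
  by (cases x; simp add: epowr_ennreal powr_powr)+

text \<open>For \<open>a > 0\<close> the power is an increasing bijection of [0,\<infinity>] whose
  inverse, the power \<open>1 / a\<close>, is increasing as well; such a map commutes with every
  supremum.\<close>

lemma epowr_SUP:
  assumes "0 < a"
  shows "epowr (SUP i\<in>I. f i) a = (SUP i\<in>I. epowr (f i) a)"
proof (rule antisym)
  have "(SUP i\<in>I. f i) \<le> epowr (SUP i\<in>I. epowr (f i) a) (1 / a)"
  proof (rule SUP_least)
    fix i assume "i \<in> I"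
    then have "epowr (epowr (f i) a) (1 / a) \<le> epowr (SUP i\<in>I. epowr (f i) a) (1 / a)"
      using assms by (intro epowr_mono SUP_upper) auto
    then show "f i \<le> epowr (SUP i\<in>I. epowr (f i) a) (1 / a)"
      using assms by (simp add: epowr_inverse)
  qed
  then have "epowr (SUP i\<in>I. f i) a \<le> epowr (epowr (SUP i\<in>I. epowr (f i) a) (1 / a)) a"
    using assms by (intro epowr_mono)
  then show "epowr (SUP i\<in>I. f i) a \<le> (SUP i\<in>I. epowr (f i) a)"
    using assms by (simp add: epowr_inverse)
  show "(SUP i\<in>I. epowr (f i) a) \<le> epowr (SUP i\<in>I. f i) a"
    using assms by (intro SUP_least epowr_mono SUP_upper)
qed

lemma borel_measurable_epowr [measurable]:
  assumes [measurable]: "f \<in> borel_measurable M"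
  shows "(\<lambda>x. epowr (f x) a) \<in> borel_measurable M"
proof -
  have "(\<lambda>x::ennreal. epowr x a) \<in> borel_measurable borel"
    unfolding epowr_def by measurable
  then show ?thesis
    by (rule measurable_compose[OF assms])
qed

text \<open>Integrability on balls gives measurability of the restrictions of \<open>w\<close> to
  balls, and at each point these restrictions are eventually equal to \<open>w\<close>.\<close>

lemma measurable_weight:
  fixes w :: "real^'n::finite \<Rightarrow> real"
  assumes "weight w"
  shows "w \<in> borel_measurable lebesgue"
proof (rule borel_measurable_LIMSEQ_real)
  show "(\<lambda>x. indicator (cball 0 (real N)) x * w x) \<in> borel_measurable lebesgue" for N
  proof -
    have "w absolutely_integrable_on (cball 0 (real N))"
      using assms unfolding weight_def by auto
    then show ?thesis
      unfolding set_integrable_def by (auto dest: borel_measurable_integrable)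
  qed
  show "(\<lambda>N. indicator (cball 0 (real N)) x * w x) \<longlonglongrightarrow> w x" for x :: "real^'n"
  proof (rule tendsto_eventually)
    obtain N0 :: nat where "norm x \<le> real N0"
      using real_arch_simple by blast
    then show "\<forall>\<^sub>F N in sequentially. indicator (cball 0 (real N)) x * w x = w x"
      by (intro eventually_sequentiallyI[of N0]) (auto simp: indicator_def)
  qed
qed

lemma nn_integral_weight_cball_finite:
  fixes w :: "real^'n::finite \<Rightarrow> real"
  assumes "weight w"
  shows "(\<integral>\<^sup>+x. ennreal (w x) * indicator (cball 0 r) x \<partial>lebesgue) < \<infinity>"
proof -
  have "w absolutely_integrable_on (cball 0 r)"
    using assms unfolding weight_def by auto
  then have "(\<integral>\<^sup>+x. ennreal (norm (indicator (cball 0 r) x *\<^sub>R w x)) \<partial>lebesgue) < \<infinity>"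
    unfolding set_integrable_def by (simp add: integrable_iff_bounded)
  also have "(\<integral>\<^sup>+x. ennreal (norm (indicator (cball 0 r) x *\<^sub>R w x)) \<partial>lebesgue)
      = (\<integral>\<^sup>+x. ennreal (w x) * indicator (cball 0 r) x \<partial>lebesgue)"
    using assms unfolding weight_def by (intro nn_integral_cong) (auto simp: indicator_def)
  finally show ?thesis .
qed

text \<open>Cutting off height and support together yields functions that are bounded and integrable
  and still increase to \<open>h\<close>, also at points where \<open>h\<close> is infinite. Both
  the duality argument and the selection of stopping cubes start from such functions.\<close>

definition trunc :: "nat \<Rightarrow> ('a::real_normed_vector \<Rightarrow> ennreal) \<Rightarrow> 'a \<Rightarrow> ennreal" where
  "trunc N h x = min (h x) (of_nat N) * indicator (cball 0 (real N)) x"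

lemma trunc_le: "trunc N h x \<le> h x"
  and trunc_le_of_nat: "trunc N h x \<le> of_nat N"
  by (auto simp: trunc_def indicator_def)

lemma trunc_less_top: "trunc N h x < top"
  by (rule le_less_trans[OF trunc_le_of_nat]) (simp add: of_nat_less_top)

lemma trunc_outside: "x \<notin> cball 0 (real N) \<Longrightarrow> trunc N h x = 0"
  by (auto simp: trunc_def)

lemma trunc_mono: "M \<le> N \<Longrightarrow> trunc M h x \<le> trunc N h x"
  unfolding trunc_def
  by (intro mult_mono min.mono) (auto simp: indicator_def of_nat_le_iff)

lemma SUP_trunc: "(SUP N. trunc N h x) = h x"
proof (rule antisym)
  show "(SUP N. trunc N h x) \<le> h x"
    by (intro SUP_least trunc_le)
  show "h x \<le> (SUP N. trunc N h x)"
  proof (rule dense_le)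
    fix y assume "y < h x"
    then have "y < top"
      by (rule less_le_trans) simp
    then obtain n where n: "y < of_nat n"
      using ennreal_Ex_less_of_nat[of y] by auto
    obtain m :: nat where "norm x \<le> real m"
      using real_arch_simple by blast
    have "(of_nat n :: ennreal) \<le> of_nat (max n m)"
      by simp
    with n have "y \<le> min (h x) (of_nat (max n m))"
      using \<open>y < h x\<close> by (intro min.boundedI) (auto intro: less_imp_le order.trans simp del: of_nat_max)
    also have "\<dots> = trunc (max n m) h x"
      using \<open>norm x \<le> real m\<close> by (simp add: trunc_def)
    also have "\<dots> \<le> (SUP N. trunc N h x)"
      by (rule SUP_upper) auto
    finally show "y \<le> (SUP N. trunc N h x)" .
  qed
qed

lemma measurable_trunc [measurable]:
  fixes h :: "'a::euclidean_space \<Rightarrow> ennreal"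
  assumes [measurable]: "h \<in> borel_measurable lebesgue"
  shows "trunc N h \<in> borel_measurable lebesgue"
proof -
  have [measurable]: "cball (0::'a) (real N) \<in> sets lebesgue"
    by simp
  show ?thesis
    unfolding trunc_def[abs_def] by measurable
qed

lemma Lp_norm_mono:
  "0 < p \<Longrightarrow> (\<And>x. f x \<le> g x) \<Longrightarrow> Lp_norm p w f \<le> Lp_norm p w g"
  unfolding Lp_norm_def by (intro epowr_mono nn_integral_mono mult_right_mono) auto

section \<open>Duality of weighted Lebesgue spaces\<close>

lemma epowr_mult_ennreal:
  assumes "0 < a" "0 < c"
  shows "epowr (x * ennreal c) a = epowr x a * ennreal (c powr a)"
proof (cases x)
  case (real r)
  then show ?thesis
    using assms by (simp add: epowr_ennreal powr_mult flip: ennreal_mult)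
next
  case top
  then show ?thesis
    using assms by (simp add: epowr_top[unfolded infinity_ennreal_def] ennreal_top_mult)
qed

lemma conjugate_exponent:
  fixes p p' :: real
  assumes "1 < p" "p' = p / (p - 1)"
  shows "1 < p'" "1 / p + 1 / p' = 1" "p' / p = p' - 1" "(p - 1) * p' = p"
proof -
  show "1 < p'" "1 / p + 1 / p' = 1" "p' / p = p' - 1" "(p - 1) * p' = p"
    unfolding assms(2) using assms(1) by (simp_all add: divide_simps) (simp_all add: algebra_simps)?
qed

text \<open>Young's inequality for the factors h u^(1/p) and g u^(-1/p); the power p' of the second
  is g^p' u^(1-p') because p'/p = p' - 1. Where u = 0 < g the exponent 1 - p' < 0 makes the dual
  weight infinite, so the right-hand side is infinite; with \<open>powr\<close> in place of
  \<open>epowr\<close> this case would fail.\<close>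

lemma Youngs_inequality_weighted:
  fixes p p' u g :: real and h :: ennreal
  assumes p: "1 < p" "p' = p / (p - 1)" and "0 \<le> u" "0 \<le> g"
  shows "h * ennreal g \<le> epowr h p * ennreal u * ennreal (1 / p)
    + epowr (ennreal g) p' * epowr (ennreal u) (1 - p') * ennreal (1 / p')"
proof -
  note conj = conjugate_exponent[OF p]
  have pos: "0 < p" "0 < p'" "0 < 1 / p" "0 < 1 / p'"
    using p conj by auto
  consider "g = 0" | "g > 0" "u = 0" | "g > 0" "u > 0" "h = top" | r where "g > 0" "u > 0" "h = ennreal r" "r \<ge> 0"
    using assms by (cases h) fastforce+
  then show ?thesis
  proof cases
    case 1
    then show ?thesis by simp
  next
    case 2
    then have "epowr (ennreal g) p' * epowr (ennreal u) (1 - p') * ennreal (1 / p') = \<infinity>"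
      using conj pos by (simp add: epowr_def ennreal_mult_top ennreal_top_mult)
    then show ?thesis by simp
  next
    case 3
    then have "epowr h p * ennreal u * ennreal (1 / p) = \<infinity>"
      using pos by (simp add: epowr_def ennreal_mult_top ennreal_top_mult)
    then show ?thesis by simp
  next
    case 4
    have "(g * u powr (- 1 / p)) powr p' = g powr p' * u powr (1 - p')"
      using 4 conj pos by (simp add: powr_mult powr_powr)
    moreover have "(r * u powr (1 / p)) powr p = r powr p * u"
      using 4 pos by (simp add: powr_mult powr_powr)
    moreover have "r * g = (r * u powr (1 / p)) * (g * u powr (- 1 / p))"
      using 4 by (simp add: powr_minus field_simps)
    moreover have "(r * u powr (1 / p)) * (g * u powr (- 1 / p))
        \<le> (r * u powr (1 / p)) powr p / p + (g * u powr (- 1 / p)) powr p' / p'"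
      using 4 p(1) conj by (intro Youngs_inequality) auto
    ultimately have "r * g \<le> r powr p * u / p + g powr p' * u powr (1 - p') / p'"
      by metis
    moreover have "epowr (ennreal u) (1 - p') = ennreal (u powr (1 - p'))"
      using 4 conj by (simp add: epowr_def)
    ultimately show ?thesis
      using 4 pos by (simp add: epowr_ennreal ennreal_leI flip: ennreal_mult ennreal_plus)
  qed
qed

text \<open>Young's inequality for h/\<alpha> and g/\<beta> is integrated and multiplied by
  \<alpha>\<beta>; the two terms add up to 1/p + 1/p' = 1. Positive upper bounds \<alpha>, \<beta>
  stand in for the norms, which could be zero and could not be divided by.\<close>

lemma Holder_inequality_weighted_aux:
  fixes u :: "real^'n::finite \<Rightarrow> real" and g :: "real^'n \<Rightarrow> real" and h :: "real^'n \<Rightarrow> ennreal"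
  assumes p: "1 < p" "p' = p / (p - 1)"
    and [measurable]: "u \<in> borel_measurable lebesgue" "g \<in> borel_measurable lebesgue"
      "h \<in> borel_measurable lebesgue"
    and nonneg: "\<And>x. 0 \<le> u x" "\<And>x. 0 \<le> g x"
    and h: "Lp_norm p (\<lambda>x. ennreal (u x)) h \<le> ennreal \<alpha>" "0 < \<alpha>"
    and g: "Lp_norm p' (\<lambda>x. epowr (ennreal (u x)) (1 - p')) (\<lambda>x. ennreal (g x)) \<le> ennreal \<beta>" "0 < \<beta>"
  shows "(\<integral>\<^sup>+x. h x * ennreal (g x) \<partial>lebesgue) \<le> ennreal (\<alpha> * \<beta>)"
proof -
  note conj = conjugate_exponent[OF p]
  have pos: "0 < p" "0 < p'" "0 < 1 / p" "0 < 1 / p'"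
    using p conj by auto
  let ?H = "\<lambda>x. epowr (h x) p * ennreal (u x)"
  let ?G = "\<lambda>x. epowr (ennreal (g x)) p' * epowr (ennreal (u x)) (1 - p')"
  have H: "(\<integral>\<^sup>+x. ?H x \<partial>lebesgue) \<le> ennreal (\<alpha> powr p)"
    using epowr_mono[OF pos(1) h(1)] h(2) pos by (simp add: Lp_norm_def epowr_inverse epowr_ennreal)
  have G: "(\<integral>\<^sup>+x. ?G x \<partial>lebesgue) \<le> ennreal (\<beta> powr p')"
    using epowr_mono[OF pos(2) g(1)] g(2) pos by (simp add: Lp_norm_def epowr_inverse epowr_ennreal)
  have "h x * ennreal (g x) \<le> ennreal (\<alpha> * \<beta>) *
      (?H x * ennreal (\<alpha> powr (- p) / p) + ?G x * ennreal (\<beta> powr (- p') / p'))" for x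
  proof -
    have "h x * ennreal (g x) = ennreal (\<alpha> * \<beta>) * ((h x * ennreal (1 / \<alpha>)) * ennreal (g x * (1 / \<beta>)))"
    proof -
      have "ennreal (\<alpha> * \<beta>) * ((h x * ennreal (1 / \<alpha>)) * ennreal (g x * (1 / \<beta>)))
          = h x * (ennreal (\<alpha> * \<beta>) * ennreal (1 / \<alpha>) * ennreal (g x * (1 / \<beta>)))"
        by (simp add: ac_simps)
      also have "ennreal (\<alpha> * \<beta>) * ennreal (1 / \<alpha>) * ennreal (g x * (1 / \<beta>)) = ennreal (g x)"
        using h(2) g(2) nonneg(2)[of x] by (simp flip: ennreal_mult)
      finally show ?thesis by simp
    qed
    also have "\<dots> \<le> ennreal (\<alpha> * \<beta>) *
      (epowr (h x * ennreal (1 / \<alpha>)) p * ennreal (u x) * ennreal (1 / p)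
        + epowr (ennreal (g x * (1 / \<beta>))) p' * epowr (ennreal (u x)) (1 - p') * ennreal (1 / p'))"
      using h(2) g(2) nonneg by (intro mult_left_mono Youngs_inequality_weighted p) auto
    also have "epowr (h x * ennreal (1 / \<alpha>)) p * ennreal (u x) * ennreal (1 / p)
        = ?H x * (ennreal ((1 / \<alpha>) powr p) * ennreal (1 / p))"
      using h(2) pos by (subst epowr_mult_ennreal) (auto simp: ac_simps)
    also have "ennreal ((1 / \<alpha>) powr p) * ennreal (1 / p) = ennreal (\<alpha> powr (- p) / p)"
      using h(2) pos by (simp add: powr_minus_divide powr_divide flip: ennreal_mult)
    also have "epowr (ennreal (g x * (1 / \<beta>))) p' * epowr (ennreal (u x)) (1 - p') * ennreal (1 / p')
        = ?G x * (ennreal ((1 / \<beta>) powr p') * ennreal (1 / p'))"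
      using g(2) pos nonneg by (subst ennreal_mult, simp, simp, subst epowr_mult_ennreal) (auto simp: ac_simps)
    also have "ennreal ((1 / \<beta>) powr p') * ennreal (1 / p') = ennreal (\<beta> powr (- p') / p')"
      using g(2) pos by (simp add: powr_minus_divide powr_divide flip: ennreal_mult)
    finally show ?thesis .
  qed
  then have "(\<integral>\<^sup>+x. h x * ennreal (g x) \<partial>lebesgue) \<le>
    (\<integral>\<^sup>+x. ennreal (\<alpha> * \<beta>) *
      (?H x * ennreal (\<alpha> powr (- p) / p) + ?G x * ennreal (\<beta> powr (- p') / p')) \<partial>lebesgue)"
    by (rule nn_integral_mono)
  also have "\<dots> = ennreal (\<alpha> * \<beta>) *
      ((\<integral>\<^sup>+x. ?H x \<partial>lebesgue) * ennreal (\<alpha> powr (- p) / p) +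
       (\<integral>\<^sup>+x. ?G x \<partial>lebesgue) * ennreal (\<beta> powr (- p') / p'))"
    by (subst nn_integral_cmult, measurable, subst nn_integral_add, measurable)
       (simp add: nn_integral_multc)
  also have "\<dots> \<le> ennreal (\<alpha> * \<beta>) *
      (ennreal (\<alpha> powr p) * ennreal (\<alpha> powr (- p) / p) +
       ennreal (\<beta> powr p') * ennreal (\<beta> powr (- p') / p'))"
    by (intro mult_left_mono add_mono mult_right_mono H G) auto
  also have "\<dots> = ennreal (\<alpha> * \<beta>) * ennreal (1 / p + 1 / p')"
    using h(2) g(2) pos by (simp add: powr_minus field_simps flip: ennreal_mult ennreal_plus)
  finally show ?thesis
    using conj by simp
qed

lemma Holder_inequality_weighted:
  fixes u :: "real^'n::finite \<Rightarrow> real" and g :: "real^'n \<Rightarrow> real" and h :: "real^'n \<Rightarrow> ennreal"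
  assumes p: "1 < p" "p' = p / (p - 1)"
    and [measurable]: "u \<in> borel_measurable lebesgue" "g \<in> borel_measurable lebesgue"
      "h \<in> borel_measurable lebesgue"
    and nonneg: "\<And>x. 0 \<le> u x" "\<And>x. 0 \<le> g x"
    and h: "Lp_norm p (\<lambda>x. ennreal (u x)) h < \<infinity>"
    and g: "Lp_norm p' (\<lambda>x. epowr (ennreal (u x)) (1 - p')) (\<lambda>x. ennreal (g x)) < \<infinity>"
  shows "(\<integral>\<^sup>+x. h x * ennreal (g x) \<partial>lebesgue) \<le> Lp_norm p (\<lambda>x. ennreal (u x)) h *
    Lp_norm p' (\<lambda>x. epowr (ennreal (u x)) (1 - p')) (\<lambda>x. ennreal (g x))"
proof -
  obtain \<alpha> where \<alpha>: "0 \<le> \<alpha>" "Lp_norm p (\<lambda>x. ennreal (u x)) h = ennreal \<alpha>"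
    using h by (cases "Lp_norm p (\<lambda>x. ennreal (u x)) h") auto
  obtain \<beta> where \<beta>: "0 \<le> \<beta>"
      "Lp_norm p' (\<lambda>x. epowr (ennreal (u x)) (1 - p')) (\<lambda>x. ennreal (g x)) = ennreal \<beta>"
    using g by (cases "Lp_norm p' (\<lambda>x. epowr (ennreal (u x)) (1 - p')) (\<lambda>x. ennreal (g x))") auto
  \<comment> \<open>Adding 1/(n+1) makes both bounds positive; the limit then covers norms equal to
    zero.\<close>
  have "(\<lambda>n. ennreal ((\<alpha> + 1 / real (Suc n)) * (\<beta> + 1 / real (Suc n)))) \<longlonglongrightarrow> ennreal ((\<alpha> + 0) * (\<beta> + 0))"
    by (intro tendsto_ennrealI tendsto_mult tendsto_add tendsto_const) (rule LIMSEQ_Suc, rule lim_1_over_n)+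
  moreover have "(\<integral>\<^sup>+x. h x * ennreal (g x) \<partial>lebesgue)
      \<le> ennreal ((\<alpha> + 1 / real (Suc n)) * (\<beta> + 1 / real (Suc n)))" for n
    using \<alpha> \<beta> by (intro Holder_inequality_weighted_aux[OF p, of u] nonneg) (auto intro!: ennreal_leI add_nonneg_pos)
  ultimately have "(\<integral>\<^sup>+x. h x * ennreal (g x) \<partial>lebesgue) \<le> ennreal ((\<alpha> + 0) * (\<beta> + 0))"
    by (intro LIMSEQ_le_const) auto
  then show ?thesis
    using \<alpha> \<beta> by (simp add: ennreal_mult)
qed

text \<open>The extremal test function is g = t^(p-1) u with t a truncation of h. For I, the
  integral of t^p u, its dual norm is I^(1/p'), so the hypothesis gives I <= c I^(1/p'), that is
  I^(1/p) <= c when 0 < I < \<infinity>. Monotone convergence removes the truncation.\<close>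

lemma Lp_norm_le_by_duality:
  fixes u :: "real^'n::finite \<Rightarrow> real" and h :: "real^'n \<Rightarrow> ennreal"
  assumes p: "1 < p" "p' = p / (p - 1)" and u: "weight u"
    and [measurable]: "h \<in> borel_measurable lebesgue"
    and dual: "\<And>g. g \<in> borel_measurable lebesgue \<Longrightarrow> (\<And>x. 0 \<le> g x) \<Longrightarrow>
      Lp_norm p' (\<lambda>x. epowr (ennreal (u x)) (1 - p')) (\<lambda>x. ennreal (g x)) < \<infinity> \<Longrightarrow>
      (\<integral>\<^sup>+x. h x * ennreal (g x) \<partial>lebesgue)
        \<le> c * Lp_norm p' (\<lambda>x. epowr (ennreal (u x)) (1 - p')) (\<lambda>x. ennreal (g x))"
  shows "Lp_norm p (\<lambda>x. ennreal (u x)) h \<le> c"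
proof -
  note conj = conjugate_exponent[OF p]
  have pos: "0 < p" "0 < p'" "0 < 1 / p" "0 < 1 / p'"
    using p conj by auto
  have [measurable]: "u \<in> borel_measurable lebesgue"
    by (rule measurable_weight[OF u])
  have u0: "0 \<le> u x" for x
    using u by (simp add: weight_def)
  let ?I = "\<lambda>N. (\<integral>\<^sup>+x. epowr (trunc N h x) p * ennreal (u x) \<partial>lebesgue)"
  have I_le: "?I N \<le> epowr c p" for N
  proof -
    let ?t = "\<lambda>x. enn2real (trunc N h x)"
    let ?g = "\<lambda>x. ?t x powr (p - 1) * u x"
    have t: "trunc N h x = ennreal (?t x)" "0 \<le> ?t x" for x
      using trunc_less_top[of N h x] by auto
    \<comment> \<open>This justifies dividing by I^(1/p') below. It is the place where local
      integrability of \<open>u\<close> is used: \<open>t\<close> is at most \<open>N\<close> and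
      vanishes outside a ball.\<close>
    have I_finite: "?I N < \<infinity>"
    proof -
      have [measurable]: "cball (0::real^'n) (real N) \<in> sets lebesgue"
        by simp
      have "?I N \<le> (\<integral>\<^sup>+x. epowr (of_nat N) p * (ennreal (u x) * indicator (cball 0 (real N)) x) \<partial>lebesgue)"
      proof (rule nn_integral_mono)
        fix x :: "real^'n"
        show "epowr (trunc N h x) p * ennreal (u x)
            \<le> epowr (of_nat N) p * (ennreal (u x) * indicator (cball 0 (real N)) x)"
        proof (cases "x \<in> cball 0 (real N)")
          case True
          then show ?thesis
            using pos by (auto intro!: mult_right_mono epowr_mono trunc_le_of_nat)
        next
          case False
          then show ?thesis
            using pos by (simp add: trunc_outside epowr_zero)
        qed
      qed
      also have "\<dots> = epowr (of_nat N) p * (\<integral>\<^sup>+x. ennreal (u x) * indicator (cball 0 (real N)) x \<partial>lebesgue)"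
        by (subst nn_integral_cmult) auto
      also have "\<dots> < \<infinity>"
        using nn_integral_weight_cball_finite[OF u, of "real N"] pos
        by (auto simp: ennreal_mult_less_top epowr_ennreal simp flip: ennreal_of_nat_eq_real_of_nat
            intro!: ennreal_mult_less_top[THEN iffD2] )
           (simp add: ennreal_of_nat_eq_real_of_nat epowr_ennreal)
      finally show ?thesis .
    qed
    have g_norm: "epowr (ennreal (?g x)) p' * epowr (ennreal (u x)) (1 - p')
        = epowr (trunc N h x) p * ennreal (u x)" for x
    \<comment> \<open>At a zero of \<open>u\<close> the test function vanishes and the dual weight
      is infinite; the convention 0 * \<infinity> = 0 gives the right value. Elsewhere (p-1)p' = p
      and u^p' u^(1-p') = u.\<close>
    proof (cases "u x = 0")
      case True
      then show ?thesis using pos by (simp add: epowr_zero)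
    next
      case False
      then have "0 < u x"
        using u0[of x] by simp
      moreover have "(?g x) powr p' = ?t x powr p * u x powr p'"
        using t(2)[of x] u0[of x] conj by (simp add: powr_mult powr_powr)
      moreover have "u x powr p' * u x powr (1 - p') = u x"
        using \<open>0 < u x\<close> by (simp flip: powr_add)
      ultimately show ?thesis
        using pos u0[of x] conj by (subst t(1)) (simp add: epowr_def[of "ennreal (u x)"] epowr_ennreal mult.assoc flip: ennreal_mult)
    qed
    then have norm_eq: "Lp_norm p' (\<lambda>x. epowr (ennreal (u x)) (1 - p')) (\<lambda>x. ennreal (?g x)) = epowr (?I N) (1 / p')"
      by (simp add: Lp_norm_def)
    obtain r where r: "?I N = ennreal r" "0 \<le> r"
      using I_finite by (cases "?I N") auto
    have "?I N \<le> (\<integral>\<^sup>+x. h x * ennreal (?g x) \<partial>lebesgue)"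
    proof (rule nn_integral_mono)
      fix x :: "real^'n"
      have "?t x powr p = ?t x * ?t x powr (p - 1)"
        using t(2)[of x] p by (cases "?t x = 0") (auto simp: powr_mult_base)
      then have "epowr (trunc N h x) p * ennreal (u x) = ennreal (?t x) * ennreal (?g x)"
        using t(2)[of x] u0[of x] pos by (subst t(1)) (simp add: epowr_ennreal mult.assoc flip: ennreal_mult)
      also have "\<dots> = trunc N h x * ennreal (?g x)"
        by (simp flip: t(1))
      also have "\<dots> \<le> h x * ennreal (?g x)"
        by (intro mult_right_mono trunc_le) auto
      finally show "epowr (trunc N h x) p * ennreal (u x) \<le> h x * ennreal (?g x)" .
    qed
    also have "\<dots> \<le> c * epowr (?I N) (1 / p')"
      unfolding norm_eq[symmetric]
      using I_finite pos r u0 by (intro dual) (auto simp: norm_eq epowr_ennreal simp del: enn2real_nonneg)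
    finally have le: "ennreal r \<le> c * ennreal (r powr (1 / p'))"
      using r pos by (simp add: epowr_ennreal)
    show ?thesis
    proof (cases c)
      case (real d)
      show ?thesis
      proof (cases "r = 0")
        case False
        then have "0 < r" using r by simp
        have "r \<le> d * r powr (1 / p')"
          using le real r by (simp flip: ennreal_mult)
        then have "r / r powr (1 / p') \<le> d"
          using \<open>0 < r\<close> by (simp add: field_simps)
        moreover have "r / r powr (1 / p') = r powr (1 / p)"
          using \<open>0 < r\<close> conj(2) powr_diff[of r 1 "1 / p'"] by (simp add: eq_diff_eq[symmetric])
        ultimately have "(r powr (1 / p)) powr p \<le> d powr p"
          using pos by (intro powr_mono2) auto
        then show ?thesis
          using r real pos \<open>0 < r\<close> by (simp add: epowr_ennreal powr_powr)
      qed (use r in simp)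
    next
      case top
      then show ?thesis
        using pos by (simp add: epowr_top[unfolded infinity_ennreal_def])
    qed
  qed
  have "(\<integral>\<^sup>+x. epowr (h x) p * ennreal (u x) \<partial>lebesgue)
      = (\<integral>\<^sup>+x. (SUP N. epowr (trunc N h x) p * ennreal (u x)) \<partial>lebesgue)"
    using pos by (intro nn_integral_cong) (simp add: epowr_SUP[symmetric] SUP_trunc flip: SUP_mult_right_ennreal)
  also have "\<dots> = (SUP N. ?I N)"
    using pos by (intro nn_integral_monotone_convergence_SUP)
      (auto intro!: incseq_SucI le_funI mult_right_mono epowr_mono trunc_mono)
  also have "\<dots> \<le> epowr c p"
    by (intro SUP_least I_le)
  finally have "Lp_norm p (\<lambda>x. ennreal (u x)) h \<le> epowr (epowr c p) (1 / p)"
    unfolding Lp_norm_def using pos by (intro epowr_mono) auto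
  then show ?thesis
    using pos by (simp add: epowr_inverse)
qed

section \<open>Cubes and sparse families\<close>

lemma cube_of_side_sandwich:
  fixes Q :: "(real^'n::finite) set"
  assumes "cube_of_side l Q"
  obtains a where "0 < l" "box a (\<chi> i. a $ i + l) \<subseteq> Q" "Q \<subseteq> cbox a (\<chi> i. a $ i + l)"
proof -
  obtain a :: "real^'n" and I where I: "\<And>i. {a $ i <..< a $ i + l} \<subseteq> I i \<and> I i \<subseteq> {a $ i .. a $ i + l}"
      and Q: "Q = {x. \<forall>i. x $ i \<in> I i}" and "0 < l"
    using assms unfolding cube_of_side_def by blast
  have "box a (\<chi> i. a $ i + l) \<subseteq> Q"
    using I unfolding Q by (auto simp: mem_box_cart subset_eq)
  moreover have "Q \<subseteq> cbox a (\<chi> i. a $ i + l)"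
    using I unfolding Q by (auto simp: mem_box_cart subset_eq)
  ultimately show thesis
    using that \<open>0 < l\<close> by blast
qed

lemma
  fixes Q :: "(real^'n::finite) set"
  assumes "cube_of_side l Q"
  shows lebesgue_measurable_cube: "Q \<in> sets lebesgue"
    and emeasure_cube: "emeasure lebesgue Q = ennreal (l ^ CARD('n))"
    and interior_cube_nonempty: "interior Q \<noteq> {}"
proof -
  obtain a where l: "0 < l" and a: "box a (\<chi> i. a $ i + l) \<subseteq> Q" "Q \<subseteq> cbox a (\<chi> i. a $ i + l)"
    using cube_of_side_sandwich[OF assms] by blast
  let ?b = "\<chi> i. a $ i + l"
  have "negligible (Q - box a ?b)"
    by (rule negligible_subset[OF negligible_frontier_interval[of a ?b]]) (use a in auto)
  then have "Q - box a ?b \<in> sets lebesgue"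
    by (rule negligible_imp_sets)
  moreover have "Q = (Q - box a ?b) \<union> box a ?b"
    using a by auto
  ultimately show Q: "Q \<in> sets lebesgue"
    by (metis sets.Un lborelD borel_open open_box sets_completionI_sets)
  have ne: "box a ?b \<noteq> {}"
    using l by (simp add: interval_ne_empty_cart)
  then show "interior Q \<noteq> {}"
    using interior_maximal[OF a(1) open_box] by auto
  have prod: "(\<Prod>b\<in>Basis. (?b - a) \<bullet> b) = l ^ CARD('n)"
  proof -
    have "(?b - a) \<bullet> b = l" if "b \<in> Basis" for b :: "real^'n"
    proof -
      obtain i where "b = axis i 1"
        using \<open>b \<in> Basis\<close> by (auto simp: Basis_vec_def)
      then show ?thesis
        by (simp add: inner_axis)
    qed
    then show ?thesis
      by simp
  qed
  have le: "a \<bullet> b \<le> ?b \<bullet> b" if "b \<in> Basis" for b :: "real^'n"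
  proof -
    obtain i where "b = axis i 1"
      using \<open>b \<in> Basis\<close> by (auto simp: Basis_vec_def)
    then show ?thesis
      using l by (simp add: inner_axis)
  qed
  have "ennreal (l ^ CARD('n)) = emeasure lebesgue (box a ?b)"
    using le prod by simp
  also have "\<dots> \<le> emeasure lebesgue Q"
    using a Q by (intro emeasure_mono)
  finally have 1: "ennreal (l ^ CARD('n)) \<le> emeasure lebesgue Q" .
  have "emeasure lebesgue Q \<le> emeasure lebesgue (cbox a ?b)"
    using a by (intro emeasure_mono) auto
  also have "\<dots> = ennreal (l ^ CARD('n))"
    using le prod by simp
  finally show "emeasure lebesgue Q = ennreal (l ^ CARD('n))"
    using 1 by (rule antisym)
qed

\<comment> \<open>As a simp rule it rewrites \<open>emeasure lebesgue\<close> into \<open>emeasure lborel\<close> of a main part.\<close>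
declare emeasure_completion [simp del]

text \<open>The side is determined by the volume, so each cube of a dyadic grid belongs to exactly
  one level.\<close>

lemma cube_of_side_unique:
  fixes Q :: "(real^'n::finite) set"
  assumes "cube_of_side l Q" "cube_of_side m Q"
  shows "l = m"
proof -
  have "0 < l" "0 < m"
    using assms by (auto simp: cube_of_side_def)
  moreover have "l ^ CARD('n) = m ^ CARD('n)"
    using emeasure_cube[OF assms(1)] emeasure_cube[OF assms(2)] \<open>0 < l\<close> \<open>0 < m\<close> by simp
  ultimately show ?thesis
    by (simp add: power_eq_iff_eq_base)
qed

lemma
  assumes "cube Q"
  shows cube_in_sets_lebesgue: "Q \<in> sets lebesgue"
    and emeasure_cube_nonzero: "emeasure lebesgue Q \<noteq> 0"
    and emeasure_cube_finite: "emeasure lebesgue Q < top"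
proof -
  obtain l where l: "cube_of_side l Q"
    using assms by (auto simp: cube_def)
  then have "0 < l"
    by (simp add: cube_of_side_def)
  show "Q \<in> sets lebesgue"
    by (rule lebesgue_measurable_cube[OF l])
  show "emeasure lebesgue Q \<noteq> 0" "emeasure lebesgue Q < top"
    using \<open>0 < l\<close> by (simp_all add: emeasure_cube[OF l])
qed

lemma average_times_measure:
  assumes "cube Q"
  shows "average Q h * emeasure lebesgue Q = (\<integral>\<^sup>+x\<in>Q. h x \<partial>lebesgue)"
  unfolding average_def using emeasure_cube_nonzero[OF assms] emeasure_cube_finite[OF assms]
  by (subst ennreal_divide_times) (simp add: ennreal_divide_self)

lemma countable_disjoint_cubes:
  assumes "disjoint \<Q>" "\<And>Q. Q \<in> \<Q> \<Longrightarrow> cube Q"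
  shows "countable \<Q>"
proof (rule countable_disjoint_nonempty_interior_subsets)
  show "pairwise disjnt \<Q>"
    using assms(1) by (simp add: disjoint_def pairwise_def disjnt_def)
  show "Q = {}" if "Q \<in> \<Q>" "interior Q = {}" for Q
    using assms(2)[OF that(1)] that(2) by (auto simp: cube_def dest: interior_cube_nonempty)
qed

lemma dyadic_grid_cube: "dyadic_grid D \<Longrightarrow> Q \<in> D \<Longrightarrow> cube Q"
  unfolding dyadic_grid_def cube_def by blast

lemma sparse_family_level:
  assumes "dyadic_grid D" "sparse_family D K S" "k \<in> K"
  shows "disjoint (S k)" "Q \<in> S k \<Longrightarrow> cube Q" "countable (S k)"
proof -
  have *: "S k \<subseteq> D" "disjoint (S k)"
    using assms(2,3) unfolding sparse_family_def by blast+
  then show "disjoint (S k)" "Q \<in> S k \<Longrightarrow> cube Q"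
    using dyadic_grid_cube[OF assms(1)] by blast+
  show "countable (S k)"
    using * dyadic_grid_cube[OF assms(1)] by (intro countable_disjoint_cubes) blast+
qed

lemma countable_sparse_family:
  assumes "dyadic_grid D" "sparse_family D K S"
  shows "countable (SIGMA k:K. S k)"
  using sparse_family_level[OF assms] by (intro countable_SIGMA) auto

text \<open>As an integral against counting measure on a countable index set, the sum over cubes can
  be exchanged with Lebesgue integrals by Tonelli's theorem.\<close>

lemma sparse_op_eq_nn_integral:
  assumes "dyadic_grid D" "sparse_family D K S"
  shows "sparse_op K S f x =
    (\<integral>\<^sup>+i. average (snd i) (\<lambda>y. ennreal (f y)) * indicator (snd i) x \<partial>count_space (SIGMA k:K. S k))"
  unfolding sparse_op_def
  by (simp add: infsum_eq_nn_integral_count_space[OF countable_sparse_family[OF assms]] case_prod_beta)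

lemma measurable_sparse_cube:
  assumes "dyadic_grid D" "sparse_family D K S" "i \<in> (SIGMA k:K. S k)"
  shows "cube (snd i)" "snd i \<in> sets lebesgue"
proof -
  show "cube (snd i)"
    using sparse_family_level(2)[OF assms(1,2)] assms(3) by auto
  then show "snd i \<in> sets lebesgue"
    by (rule cube_in_sets_lebesgue)
qed

lemma borel_measurable_nn_integral_count_space:
  fixes f :: "'i \<Rightarrow> 'a \<Rightarrow> ennreal"
  assumes "countable I" and [measurable]: "\<And>i. i \<in> I \<Longrightarrow> f i \<in> borel_measurable M"
  shows "(\<lambda>x. \<integral>\<^sup>+i. f i x \<partial>count_space I) \<in> borel_measurable M"
proof (cases "finite I")
  case True
  then show ?thesis
    by (simp add: nn_integral_count_space_finite)
next
  case False
  then have [simp]: "I \<noteq> {}"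
    by auto
  have "(\<integral>\<^sup>+i. f i x \<partial>count_space I) = (\<Sum>n. f (from_nat_into I n) x)" for x
    by (simp add: nn_integral_bij_count_space[symmetric, OF bij_betw_from_nat_into[OF assms(1) False]]
        nn_integral_count_space_nat)
  then show ?thesis
    by (simp add: from_nat_into)
qed

lemma measurable_sparse_op:
  assumes "dyadic_grid D" "sparse_family D K S"
  shows "sparse_op K S f \<in> borel_measurable lebesgue"
  unfolding sparse_op_eq_nn_integral[OF assms, abs_def]
  using measurable_sparse_cube[OF assms]
  by (intro borel_measurable_nn_integral_count_space countable_sparse_family[OF assms])
     (auto intro!: borel_measurable_times_ennreal borel_measurable_indicator)

lemma nn_integral_sparse_op_times:
  assumes S: "dyadic_grid D" "sparse_family D K S"
    and [measurable]: "g \<in> borel_measurable lebesgue"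
  shows "(\<integral>\<^sup>+x. sparse_op K S f x * ennreal (g x) \<partial>lebesgue) =
    (\<integral>\<^sup>+i. average (snd i) (\<lambda>y. ennreal (f y)) * average (snd i) (\<lambda>y. ennreal (g y)) *
      emeasure lebesgue (snd i) \<partial>count_space (SIGMA k:K. S k))"
proof -
  let ?I = "SIGMA k:K. S k"
  let ?f = "\<lambda>i. average (snd i) (\<lambda>y. ennreal (f y))"
  let ?g = "\<lambda>i. average (snd i) (\<lambda>y. ennreal (g y))"
  note cube = measurable_sparse_cube[OF S]
  note count = countable_sparse_family[OF S]
  have "(\<integral>\<^sup>+x. sparse_op K S f x * ennreal (g x) \<partial>lebesgue) =
      (\<integral>\<^sup>+x. (\<integral>\<^sup>+i. ?f i * (ennreal (g x) * indicator (snd i) x) \<partial>count_space ?I) \<partial>lebesgue)"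
    unfolding sparse_op_eq_nn_integral[OF S]
    by (intro nn_integral_cong, subst nn_integral_multc[symmetric]) (auto simp: ac_simps)
  also have "\<dots> = (\<integral>\<^sup>+i. (\<integral>\<^sup>+x. ?f i * (ennreal (g x) * indicator (snd i) x) \<partial>lebesgue) \<partial>count_space ?I)"
    using cube(2) by (intro nn_integral_count_space_nn_integral count)
      (auto intro!: borel_measurable_times_ennreal borel_measurable_indicator)
  also have "\<dots> = (\<integral>\<^sup>+i. ?f i * ?g i * emeasure lebesgue (snd i) \<partial>count_space ?I)"
  proof (rule nn_integral_cong)
    fix i assume "i \<in> space (count_space ?I)"
    then have i: "i \<in> ?I" by simp
    have [measurable]: "snd i \<in> sets lebesgue"
      by (rule cube(2)[OF i])
    show "(\<integral>\<^sup>+x. ?f i * (ennreal (g x) * indicator (snd i) x) \<partial>lebesgue)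
        = ?f i * ?g i * emeasure lebesgue (snd i)"
      unfolding mult.assoc average_times_measure[OF cube(1)[OF i]]
      by (rule nn_integral_cmult) measurable
  qed
  finally show ?thesis .
qed

text \<open>The values of \<open>S\<close> outside \<open>K\<close> are arbitrary, so a last level
  must be treated separately: nothing is removed from its cubes.\<close>

definition sparse_core :: "int set \<Rightarrow> (int \<Rightarrow> 'a set set) \<Rightarrow> int \<times> 'a set \<Rightarrow> 'a set" where
  "sparse_core K S i = snd i - (if fst i + 1 \<in> K then \<Union>(S (fst i + 1)) else {})"

lemma sparse_family_decreasing:
  assumes S: "sparse_family D K S" and "k \<in> K" "l \<in> K" "k \<le> l"
  shows "\<Union>(S l) \<subseteq> \<Union>(S k)"
  using assms(4,3)
proof (induction l rule: int_ge_induct)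
  case (step l)
  have "l \<in> {k..l + 1}" "{k..l + 1} \<subseteq> K"
    using S step assms(2) unfolding sparse_family_def by auto
  then have "l \<in> K" by blast
  then have "\<Union>(S (l + 1)) \<subseteq> \<Union>(S l)"
    using S step unfolding sparse_family_def by blast
  then show ?case
    using step \<open>l \<in> K\<close> by blast
qed simp

lemma sparse_core_disjoint_levels:
  assumes S: "sparse_family D K S" and "k \<in> K" "l \<in> K" "k < l" "R \<in> S l"
  shows "sparse_core K S (k, Q) \<inter> sparse_core K S (l, R) = {}"
proof -
  have "k + 1 \<in> {k..l}" "{k..l} \<subseteq> K"
    using assms unfolding sparse_family_def by auto
  then have "k + 1 \<in> K" by blast
  then have "\<Union>(S l) \<subseteq> \<Union>(S (k + 1))"
    using assms by (intro sparse_family_decreasing[OF S]) auto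
  then show ?thesis
    using \<open>k + 1 \<in> K\<close> \<open>R \<in> S l\<close> by (auto simp: sparse_core_def)
qed

text \<open>Within one level the cubes themselves are disjoint. For levels k < l the core at level l
  lies in \<Omega>_l, hence in \<Omega>_(k+1), which every core at level k avoids; that k + 1 is a
  level follows from \<open>K\<close> being an interval.\<close>

lemma disjoint_family_sparse_core:
  assumes S: "sparse_family D K S"
  shows "disjoint_family_on (sparse_core K S) (SIGMA k:K. S k)"
  unfolding disjoint_family_on_def
proof (intro ballI impI)
  fix i j
  assume ij: "i \<in> (SIGMA k:K. S k)" "j \<in> (SIGMA k:K. S k)" "i \<noteq> j"
  obtain k Q where i: "i = (k, Q)" "k \<in> K" "Q \<in> S k"
    using ij(1) by auto
  obtain l R where j: "j = (l, R)" "l \<in> K" "R \<in> S l"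
    using ij(2) by auto
  consider "k < l" | "l < k" | "k = l"
    by linarith
  then show "sparse_core K S i \<inter> sparse_core K S j = {}"
  proof cases
    case 1
    then show ?thesis
      using sparse_core_disjoint_levels[OF S] i j by auto
  next
    case 2
    then show ?thesis
      using sparse_core_disjoint_levels[OF S, of l k Q R] i j by auto
  next
    case 3
    then have "Q \<noteq> R"
      using i j ij(3) by auto
    moreover have "disjoint (S k)"
      using S i(2) unfolding sparse_family_def by blast
    ultimately have "Q \<inter> R = {}"
      using i j 3 by (auto simp: disjoint_def)
    then show ?thesis
      by (auto simp: i j sparse_core_def)
  qed
qed

lemma emeasure_sparse_core:
  assumes S: "dyadic_grid D" "sparse_family D K S" and i: "i \<in> (SIGMA k:K. S k)"
  shows "sparse_core K S i \<in> sets lebesgue"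
    and "emeasure lebesgue (snd i) \<le> 2 * emeasure lebesgue (sparse_core K S i)"
proof -
  obtain k Q where kQ: "i = (k, Q)" "k \<in> K" "Q \<in> S k"
    using i by auto
  have Q[measurable]: "Q \<in> sets lebesgue"
    using measurable_sparse_cube[OF S i] kQ by simp
  define W where "W = (if k + 1 \<in> K then \<Union>(S (k + 1)) else {})"
  have W[measurable]: "W \<in> sets lebesgue"
  proof (cases "k + 1 \<in> K")
    case True
    have "R \<in> sets lebesgue" if "R \<in> S (k + 1)" for R
      using sparse_family_level(2)[OF S True that] by (rule cube_in_sets_lebesgue)
    then show ?thesis
      unfolding W_def using sparse_family_level(3)[OF S True] True by (auto intro!: sets.countable_Union)
  qed (auto simp: W_def)
  have core: "sparse_core K S i = Q - W"
    by (simp add: sparse_core_def kQ W_def)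
  then show "sparse_core K S i \<in> sets lebesgue"
    by simp
  have half: "emeasure lebesgue (W \<inter> Q) \<le> emeasure lebesgue Q / 2"
    using S(2) kQ unfolding sparse_family_def W_def by (cases "k + 1 \<in> K") auto
  obtain l where "cube_of_side l Q"
    using measurable_sparse_cube(1)[OF S i] kQ by (auto simp: cube_def)
  \<comment> \<open>The finite measure of the cube allows the computation to be done in the reals,
    where the removed half can be subtracted.\<close>
  then obtain m where m: "emeasure lebesgue Q = ennreal m" "0 \<le> m"
    using emeasure_cube by (metis cube_of_side_def less_imp_le zero_le_power)
  have split: "emeasure lebesgue Q = emeasure lebesgue (W \<inter> Q) + emeasure lebesgue (Q - W)"
    by (subst plus_emeasure) (auto intro!: arg_cong[where f = "emeasure lebesgue"])
  obtain a where a: "emeasure lebesgue (W \<inter> Q) = ennreal a" "0 \<le> a"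
    using m split by (cases "emeasure lebesgue (W \<inter> Q)") auto
  obtain b where b: "emeasure lebesgue (Q - W) = ennreal b" "0 \<le> b"
    using m split by (cases "emeasure lebesgue (Q - W)") (auto simp: ennreal_add_eq_top)
  have "m = a + b"
    using split m a b by (simp flip: ennreal_plus)
  moreover have "ennreal m / 2 = ennreal (m / 2)"
    using divide_ennreal[of m 2] m(2) by simp
  then have "a \<le> m / 2"
    using half m a by simp
  ultimately have "m \<le> 2 * b"
    by simp
  then have "ennreal m \<le> 2 * ennreal b"
    using b by (metis ennreal_leI ennreal_mult' ennreal_numeral zero_le_numeral)
  then show "emeasure lebesgue (snd i) \<le> 2 * emeasure lebesgue (sparse_core K S i)"
    using m b core kQ(1) by simp
qed

lemma nn_integral_sparse_op_le_bilinear_maximal: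
  assumes S: "dyadic_grid D" "sparse_family D K S"
    and [measurable]: "g \<in> borel_measurable lebesgue"
    and nonneg: "\<And>x. 0 \<le> f x" "\<And>x. 0 \<le> g x"
  shows "(\<integral>\<^sup>+x. sparse_op K S f x * ennreal (g x) \<partial>lebesgue)
    \<le> 2 * (\<integral>\<^sup>+x. bilinear_maximal f g x \<partial>lebesgue)"
proof -
  let ?I = "SIGMA k:K. S k"
  let ?f = "\<lambda>i. average (snd i) (\<lambda>y. ennreal (f y))"
  let ?g = "\<lambda>i. average (snd i) (\<lambda>y. ennreal (g y))"
  let ?E = "sparse_core K S"
  note count = countable_sparse_family[OF S]
  have "(\<integral>\<^sup>+x. sparse_op K S f x * ennreal (g x) \<partial>lebesgue) =
      (\<integral>\<^sup>+i. ?f i * ?g i * emeasure lebesgue (snd i) \<partial>count_space ?I)"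
    by (rule nn_integral_sparse_op_times[OF S]) measurable
  also have "\<dots> \<le> (\<integral>\<^sup>+i. 2 * (?f i * ?g i * emeasure lebesgue (?E i)) \<partial>count_space ?I)"
  proof (rule nn_integral_mono)
    fix i assume "i \<in> space (count_space ?I)"
    then have "?f i * ?g i * emeasure lebesgue (snd i) \<le> ?f i * ?g i * (2 * emeasure lebesgue (?E i))"
      using emeasure_sparse_core[OF S] by (intro mult_left_mono) auto
    then show "?f i * ?g i * emeasure lebesgue (snd i) \<le> 2 * (?f i * ?g i * emeasure lebesgue (?E i))"
      by (simp add: ac_simps)
  qed
  also have "\<dots> = 2 * (\<integral>\<^sup>+i. ?f i * ?g i * emeasure lebesgue (?E i) \<partial>count_space ?I)"
    by (rule nn_integral_cmult) simp
  also have "(\<integral>\<^sup>+i. ?f i * ?g i * emeasure lebesgue (?E i) \<partial>count_space ?I)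
      = (\<integral>\<^sup>+i. (\<integral>\<^sup>+x. ?f i * ?g i * indicator (?E i) x \<partial>lebesgue) \<partial>count_space ?I)"
    using emeasure_sparse_core[OF S] by (intro nn_integral_cong) (simp add: nn_integral_cmult_indicator)
  also have "\<dots> = (\<integral>\<^sup>+x. (\<integral>\<^sup>+i. ?f i * ?g i * indicator (?E i) x \<partial>count_space ?I) \<partial>lebesgue)"
    using emeasure_sparse_core[OF S] by (intro nn_integral_count_space_nn_integral[symmetric] count) auto
  also have "\<dots> \<le> (\<integral>\<^sup>+x. bilinear_maximal f g x \<partial>lebesgue)"
  proof (rule nn_integral_mono)
    fix x
    show "(\<integral>\<^sup>+i. ?f i * ?g i * indicator (?E i) x \<partial>count_space ?I) \<le> bilinear_maximal f g x"
    \<comment> \<open>Since the cores are disjoint, at most one term of the sum is nonzero at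
      \<open>x\<close>, and that term is a competitor in the supremum defining the maximal
      function.\<close>
    proof (cases "\<exists>i\<in>?I. x \<in> ?E i")
      case True
      then obtain i where i: "i \<in> ?I" "x \<in> ?E i" by blast
      have "x \<notin> ?E j" if "j \<in> ?I" "j \<noteq> i" for j
        using disjoint_family_sparse_core[OF S(2)] i that unfolding disjoint_family_on_def by blast
      then have "(\<integral>\<^sup>+j. ?f j * ?g j * indicator (?E j) x \<partial>count_space ?I)
          = (\<Sum>j\<in>{i}. ?f j * ?g j * indicator (?E j) x)"
        using i(1) by (intro nn_integral_count_space') auto
      also have "\<dots> = ?f i * ?g i"
        using i(2) by simp
      also have "\<dots> \<le> bilinear_maximal f g x"
        unfolding bilinear_maximal_def
        using measurable_sparse_cube(1)[OF S i(1)] i(2) nonneg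
        by (intro SUP_upper2[of "snd i"]) (auto simp: sparse_core_def)
      finally show ?thesis .
    next
      case False
      then have "(\<integral>\<^sup>+j. ?f j * ?g j * indicator (?E j) x \<partial>count_space ?I) = (\<integral>\<^sup>+j. 0 \<partial>count_space ?I)"
        by (intro nn_integral_cong) auto
      then show ?thesis by simp
    qed
  qed
  finally show ?thesis
    by (simp add: mult_left_mono)
qed

lemma sparse_op_norm_le:
  fixes u v :: "real^'n::finite \<Rightarrow> real"
  assumes p: "1 < p" "p' = p / (p - 1)" and u: "weight u"
    and S: "dyadic_grid D" "sparse_family D K S"
  shows "sparse_op_norm p v u K S \<le> 2 * bilinear_maximal_norm p v p' u"
proof -
  \<comment> \<open>With the factor 2 moved to the left, the right-hand side is a bare infimum, and
    it suffices to compare with each admissible constant.\<close>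
  have "sparse_op_norm p v u K S / 2 \<le> bilinear_maximal_norm p v p' u"
    unfolding bilinear_maximal_norm_def
  proof (rule Inf_greatest, clarify)
    fix C :: ennreal
    assume C: "\<forall>f\<in>borel_measurable lebesgue. \<forall>g\<in>borel_measurable lebesgue.
      Lp_norm p (\<lambda>x. ennreal (v x)) (\<lambda>x. ennreal \<bar>f x\<bar>) < \<infinity> \<and>
      Lp_norm p' (\<lambda>x. epowr (ennreal (u x)) (1 - p')) (\<lambda>x. ennreal \<bar>g x\<bar>) < \<infinity> \<longrightarrow>
      (\<integral>\<^sup>+x. bilinear_maximal f g x \<partial>lebesgue)
        \<le> C * (Lp_norm p (\<lambda>x. ennreal (v x)) (\<lambda>x. ennreal \<bar>f x\<bar>) *
               Lp_norm p' (\<lambda>x. epowr (ennreal (u x)) (1 - p')) (\<lambda>x. ennreal \<bar>g x\<bar>))"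
    have "sparse_op_norm p v u K S \<le> 2 * C"
      unfolding sparse_op_norm_def
    proof (rule Inf_lower, clarify)
      fix f :: "real^'n \<Rightarrow> real"
      let ?F = "Lp_norm p (\<lambda>x. ennreal (v x)) (\<lambda>x. ennreal (f x))"
      assume f: "f \<in> borel_measurable lebesgue" "\<forall>x. 0 \<le> f x" "?F < \<infinity>"
      show "Lp_norm p (\<lambda>x. ennreal (u x)) (sparse_op K S f) \<le> 2 * C * ?F"
      proof (rule Lp_norm_le_by_duality[OF p u measurable_sparse_op[OF S]])
        fix g :: "real^'n \<Rightarrow> real"
        let ?G = "Lp_norm p' (\<lambda>x. epowr (ennreal (u x)) (1 - p')) (\<lambda>x. ennreal (g x))"
        assume g: "g \<in> borel_measurable lebesgue" "\<And>x. 0 \<le> g x" "?G < \<infinity>"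
        have "(\<integral>\<^sup>+x. sparse_op K S f x * ennreal (g x) \<partial>lebesgue)
            \<le> 2 * (\<integral>\<^sup>+x. bilinear_maximal f g x \<partial>lebesgue)"
          using f g by (intro nn_integral_sparse_op_le_bilinear_maximal[OF S]) auto
        also have "(\<integral>\<^sup>+x. bilinear_maximal f g x \<partial>lebesgue) \<le> C * (?F * ?G)"
          using C[rule_format, OF f(1) g(1)] f g by simp
        finally show "(\<integral>\<^sup>+x. sparse_op K S f x * ennreal (g x) \<partial>lebesgue) \<le> 2 * C * ?F * ?G"
          by (simp add: mult_left_mono mult.assoc)
      qed
    qed
    then show "sparse_op_norm p v u K S / 2 \<le> C"
      by (intro divide_le_posI_ennreal) auto
  qed
  then have "2 * (sparse_op_norm p v u K S / 2) \<le> 2 * bilinear_maximal_norm p v p' u"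
    by (rule mult_left_mono) simp
  then show ?thesis
    by (simp add: ennreal_times_divide mult.commute[of 2 "sparse_op_norm p v u K S"] ennreal_mult_divide_eq)
qed

section \<open>Shifted dyadic grids\<close>

text \<open>Counted in thirds of the side, which keeps it an integer: the intervals of length 2^k
  are translated by 0 or by (-1)^k 2^k/3.\<close>

definition grid_shift :: "bool \<Rightarrow> int \<Rightarrow> int" where
  "grid_shift b k = (if \<not> b then 0 else if even k then 1 else - 1)"

definition shift_index :: "bool \<Rightarrow> int \<Rightarrow> real \<Rightarrow> int" where
  "shift_index b k x = \<lfloor>x / 2 powi k - grid_shift b k / 3\<rfloor>"

text \<open>Each coordinate has its own choice in \<open>\<tau>\<close>, because the family of
  intervals that suits a given cube may differ from one side of the cube to the next. This is the
  origin of the number 2^n of grids.\<close>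

definition shifted_cell :: "('n \<Rightarrow> bool) \<Rightarrow> int \<Rightarrow> real^'n::finite \<Rightarrow> (real^'n) set" where
  "shifted_cell \<tau> k x = {y. \<forall>i. shift_index (\<tau> i) k (y $ i) = shift_index (\<tau> i) k (x $ i)}"

definition shifted_grid :: "('n \<Rightarrow> bool) \<Rightarrow> (real^'n::finite) set set" where
  "shifted_grid \<tau> = {shifted_cell \<tau> k x | k x. True}"

text \<open>
  The alternating sign of the shift makes the intervals nested: the shift of level \<open>k + 1\<close>, measured
  in units of \<open>2\<^sup>k\<close>, differs by an integer from that of level \<open>k\<close>.
\<close>

lemma shift_index_Suc: "shift_index b (k + 1) x = (shift_index b k x + grid_shift b k) div 2"
proof -
  have "grid_shift b (k + 1) = - grid_shift b k"
    by (simp add: grid_shift_def)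
  then have "x / 2 powi (k + 1) - grid_shift b (k + 1) / 3
      = (x / 2 powi k - grid_shift b k / 3 + grid_shift b k) / 2"
    by (simp add: power_int_add field_simps)
  then have "shift_index b (k + 1) x
      = \<lfloor>(x / 2 powi k - grid_shift b k / 3 + grid_shift b k) / real_of_int 2\<rfloor>"
    unfolding shift_index_def by (simp only: of_int_numeral)
  also have "\<dots> = \<lfloor>x / 2 powi k - grid_shift b k / 3 + grid_shift b k\<rfloor> div 2"
    by (rule floor_divide_real_eq_div) simp
  also have "\<dots> = (shift_index b k x + grid_shift b k) div 2"
    unfolding shift_index_def by (simp only: floor_add_int)
  finally show ?thesis .
qed

lemma self_in_shifted_cell: "x \<in> shifted_cell \<tau> k x"
  by (simp add: shifted_cell_def)

lemma shifted_cell_eq: "y \<in> shifted_cell \<tau> k x \<Longrightarrow> shifted_cell \<tau> k y = shifted_cell \<tau> k x"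
  by (auto simp: shifted_cell_def)

text \<open>By \<open>shift_index_Suc\<close> the index at level l + 1 is a function of the index at
  level l, so points that share the latter share the former.\<close>

lemma shifted_cell_mono:
  assumes "k \<le> l"
  shows "shifted_cell \<tau> k x \<subseteq> shifted_cell \<tau> l x"
  using assms
proof (induction l rule: int_ge_induct)
  case (step l)
  have "shifted_cell \<tau> l x \<subseteq> shifted_cell \<tau> (l + 1) x"
    by (auto simp: shifted_cell_def shift_index_Suc)
  with step show ?case by blast
qed simp

lemma shift_index_eq_iff:
  "shift_index b k y = m \<longleftrightarrow>
    2 powi k * (real_of_int m + grid_shift b k / 3) \<le> y \<and>
    y < 2 powi k * (real_of_int m + grid_shift b k / 3) + 2 powi k"
proof -
  have "shift_index b k y = m \<longleftrightarrow>
    real_of_int m \<le> y / 2 powi k - grid_shift b k / 3 \<and>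
    y / 2 powi k - grid_shift b k / 3 < real_of_int m + 1"
    unfolding shift_index_def by (rule floor_eq_iff)
  also have "\<dots> \<longleftrightarrow> 2 powi k * (real_of_int m + grid_shift b k / 3) \<le> y \<and>
    y < 2 powi k * (real_of_int m + grid_shift b k / 3) + 2 powi k"
    by (auto simp: field_simps)
  finally show ?thesis .
qed

lemma shifted_cell_cube: "cube_of_side (2 powi k) (shifted_cell \<tau> k x)"
proof -
  define a :: "real^'a" where "a = (\<chi> i. 2 powi k *
    (real_of_int (shift_index (\<tau> i) k (x $ i)) + grid_shift (\<tau> i) k / 3))"
  have "shifted_cell \<tau> k x = {y. \<forall>i. y $ i \<in> {a $ i ..< a $ i + 2 powi k}}"
    by (auto simp: shifted_cell_def a_def shift_index_eq_iff)
  moreover have "{a $ i <..< a $ i + 2 powi k} \<subseteq> {a $ i ..< a $ i + 2 powi k}"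
    "{a $ i ..< a $ i + 2 powi k} \<subseteq> {a $ i .. a $ i + 2 powi k}" for i
    by auto
  ultimately show ?thesis
    unfolding cube_of_side_def by (intro conjI exI[of _ a] exI[of _ "\<lambda>i. {a $ i ..< a $ i + 2 powi k}"]) auto
qed

lemma two_powi_eq_iff: "(2::real) powi k = 2 powi l \<longleftrightarrow> k = l"
proof -
  have "(2::real) powr real_of_int k = 2 powr real_of_int l \<longleftrightarrow> k = l"
    by (simp add: powr_inj)
  then show ?thesis
    by (simp add: powr_real_of_int')
qed

lemma dyadic_grid_shifted_grid: "dyadic_grid (shifted_grid \<tau> :: (real^'n::finite) set set)"
  unfolding dyadic_grid_def
proof (intro conjI ballI allI)
  fix Q :: "(real^'n) set" assume "Q \<in> shifted_grid \<tau>"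
  then show "\<exists>k. cube_of_side (2 powi k) Q"
    using shifted_cell_cube by (auto simp: shifted_grid_def)
next
  fix Q R :: "(real^'n) set" assume "Q \<in> shifted_grid \<tau>" "R \<in> shifted_grid \<tau>"
  then obtain k x l y where QR: "Q = shifted_cell \<tau> k x" "R = shifted_cell \<tau> l y"
    by (auto simp: shifted_grid_def)
  show "Q \<inter> R \<in> {Q, R, {}}"
  proof (cases "Q \<inter> R = {}")
    case False
    then obtain z where "z \<in> Q" "z \<in> R" by blast
    then have "Q = shifted_cell \<tau> k z" "R = shifted_cell \<tau> l z"
      using shifted_cell_eq QR by metis+
    then have "Q \<subseteq> R \<or> R \<subseteq> Q"
      using shifted_cell_mono[of k l \<tau> z] shifted_cell_mono[of l k \<tau> z] by (cases "k \<le> l") auto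
    then show ?thesis by blast
  qed simp
next
  fix k :: int
  have "{Q \<in> shifted_grid \<tau>. cube_of_side (2 powi k) Q} = range (shifted_cell \<tau> k)"
  proof (intro equalityI subsetI)
    fix Q :: "(real^'n) set" assume "Q \<in> {Q \<in> shifted_grid \<tau>. cube_of_side (2 powi k) Q}"
    then obtain l x where Q: "Q = shifted_cell \<tau> l x" "cube_of_side (2 powi k) Q"
      by (auto simp: shifted_grid_def)
    then have "(2::real) powi k = 2 powi l"
      using cube_of_side_unique shifted_cell_cube by metis
    then have "k = l"
      by (simp add: two_powi_eq_iff)
    then show "Q \<in> range (shifted_cell \<tau> k)"
      using Q by simp
  qed (auto simp: shifted_grid_def shifted_cell_cube)
  moreover have "partition_on UNIV (range (shifted_cell \<tau> k))"
  proof (rule partition_onI)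
    show "\<Union>(range (shifted_cell \<tau> k)) = UNIV"
      using self_in_shifted_cell by blast
    show "{} \<notin> range (shifted_cell \<tau> k)"
      using self_in_shifted_cell by (metis empty_iff imageE)
    show "disjnt Q R" if "Q \<in> range (shifted_cell \<tau> k)" "R \<in> range (shifted_cell \<tau> k)" "Q \<noteq> R" for Q R :: "(real^'n) set"
    proof (rule ccontr)
      assume "\<not> disjnt Q R"
      then obtain z where "z \<in> Q" "z \<in> R"
        by (auto simp: disjnt_def)
      then have "Q = shifted_cell \<tau> k z" "R = shifted_cell \<tau> k z"
        using that(1,2) shifted_cell_eq by (metis imageE)+
      then show False
        using that(3) by simp
    qed
  qed
  ultimately show "partition_on UNIV {Q \<in> shifted_grid \<tau>. cube_of_side (2 powi k) Q}"
    by simp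
qed

text \<open>
  The end points of the intervals of the two families of length \<open>2\<^sup>k\<close> have mutual distance at
  least \<open>2\<^sup>k/3\<close>, so a shorter interval misses the end points of one of them.
\<close>

lemma interval_shift_index_const:
  assumes "3 * l < 2 powi k"
  obtains b where "\<And>x. a \<le> x \<Longrightarrow> x \<le> a + l \<Longrightarrow> shift_index b k x = shift_index b k a"
proof -
  let ?h = "(2::real) powi k"
  have h: "0 < ?h" by simp
  \<comment> \<open>If the index changes between \<open>a\<close> and \<open>x\<close>, then the
    left end point of the interval containing \<open>x\<close> lies in (a, x]; \<open>e\<close> is
    its distance from \<open>a\<close>.\<close>
  have jump: "\<exists>m::int. \<exists>e. 0 \<le> e \<and> e \<le> l \<and> a + e = ?h * (real_of_int m + grid_shift b k / 3)"
    if "a \<le> x" "x \<le> a + l" "shift_index b k x \<noteq> shift_index b k a" for x b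
  proof -
    let ?s = "real_of_int (grid_shift b k) / 3"
    let ?m = "shift_index b k x"
    have "a / ?h - ?s \<le> x / ?h - ?s"
      using that(1) h by (simp add: divide_right_mono)
    then have "shift_index b k a \<le> ?m"
      unfolding shift_index_def by (rule floor_mono)
    then have "shift_index b k a < ?m"
      using that(3) by simp
    then have "a / ?h - ?s < ?m"
      unfolding shift_index_def[of b k a] by (simp add: floor_less_iff)
    then have "a < ?h * (real_of_int ?m + ?s)"
      using h by (simp add: field_simps)
    moreover have "?h * (real_of_int ?m + ?s) \<le> x"
      using shift_index_eq_iff[of b k x ?m] by blast
    ultimately show ?thesis
      using that(2) by (intro exI[of _ ?m] exI[of _ "?h * (real_of_int ?m + ?s) - a"]) auto
  qed
  have "(\<forall>x. a \<le> x \<and> x \<le> a + l \<longrightarrow> shift_index True k x = shift_index True k a) \<or>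
      (\<forall>x. a \<le> x \<and> x \<le> a + l \<longrightarrow> shift_index False k x = shift_index False k a)"
  proof (rule ccontr)
    assume "\<not> ?thesis"
    then obtain x y where "a \<le> x" "x \<le> a + l" "shift_index True k x \<noteq> shift_index True k a"
      "a \<le> y" "y \<le> a + l" "shift_index False k y \<noteq> shift_index False k a"
      by blast
    then obtain m n :: int and d e where
      d: "0 \<le> d" "d \<le> l" "a + d = ?h * (real_of_int m + grid_shift True k / 3)" and
      e: "0 \<le> e" "e \<le> l" "a + e = ?h * real_of_int n"
      using jump[of x True] jump[of y False] by (auto simp: grid_shift_def[of False])
    \<comment> \<open>In units of a third of \<open>?h\<close> the signed distance between the two
      end points is \<open>c\<close>, which the shift makes congruent to 1 or -1 modulo 3. Two end
      points in an interval of length \<open>l < ?h / 3\<close> would force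
      \<open>c = 0\<close>.\<close>
    define c :: int where "c = 3 * (m - n) + grid_shift True k"
    have "3 * (d - e) = ?h * real_of_int c"
    proof -
      have "d - e = ?h * (real_of_int m + grid_shift True k / 3) - ?h * real_of_int n"
        using d e by simp
      then show ?thesis
        by (simp add: c_def algebra_simps)
    qed
    moreover have "\<bar>3 * (d - e)\<bar> < ?h"
      using d e assms by auto
    ultimately have "?h * \<bar>real_of_int c\<bar> < ?h * 1"
      using h by (simp add: abs_mult)
    then have "\<bar>real_of_int c\<bar> < 1"
      using h by (simp only: mult_less_cancel_left_pos)
    then have "c = 0"
      by linarith
    moreover have "c mod 3 \<noteq> 0"
      unfolding c_def grid_shift_def by presburger
    ultimately show False
      by simp
  qed
  then show thesis
    using that by blast
qed

lemma cube_in_shifted_grid: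
  fixes Q :: "(real^'n::finite) set"
  assumes "cube Q"
  obtains \<tau> R where "R \<in> shifted_grid \<tau>" "Q \<subseteq> R"
    "emeasure lebesgue R \<le> ennreal (6 ^ CARD('n)) * emeasure lebesgue Q"
proof -
  obtain l where l: "cube_of_side l Q"
    using assms by (auto simp: cube_def)
  obtain a where a: "0 < l" "Q \<subseteq> cbox a (\<chi> i. a $ i + l)"
    using cube_of_side_sandwich[OF l] by metis
  \<comment> \<open>The unique integer with 3 l < 2^k <= 6 l. The lower bound is what
    \<open>interval_shift_index_const\<close> asks for; the upper bound produces the volume ratio
    6^n.\<close>
  define k :: int where "k = \<lfloor>log 2 (3 * l)\<rfloor> + 1"
  have powi: "(2::real) powi j = 2 powr real_of_int j" for j
    by (simp add: powr_real_of_int')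
  have "3 * l = 2 powr (log 2 (3 * l))"
    using a by simp
  also have "\<dots> < 2 powr real_of_int k"
    by (intro powr_less_mono) (simp_all add: k_def)
  finally have lower: "3 * l < 2 powi k"
    by (simp add: powi)
  have "2 powi k = 2 * 2 powr real_of_int \<lfloor>log 2 (3 * l)\<rfloor>"
    by (simp add: powi k_def powr_add)
  also have "\<dots> \<le> 2 * 2 powr (log 2 (3 * l))"
    by (intro mult_left_mono powr_mono) auto
  also have "\<dots> = 6 * l"
    using a by simp
  finally have upper: "2 powi k \<le> 6 * l" .
  have "\<forall>i. \<exists>b. \<forall>x. a $ i \<le> x \<and> x \<le> a $ i + l \<longrightarrow> shift_index b k x = shift_index b k (a $ i)"
    using interval_shift_index_const[OF lower] by metis
  then obtain \<tau> where \<tau>: "\<And>i x. a $ i \<le> x \<Longrightarrow> x \<le> a $ i + l \<Longrightarrow>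
      shift_index (\<tau> i) k x = shift_index (\<tau> i) k (a $ i)"
    by metis
  have "Q \<subseteq> shifted_cell \<tau> k a"
    using a(2) \<tau> by (auto simp: shifted_cell_def mem_box_cart subset_eq)
  moreover have "emeasure lebesgue (shifted_cell \<tau> k a) \<le> ennreal (6 ^ CARD('n)) * emeasure lebesgue Q"
  proof -
    have "(2 powi k) ^ CARD('n) \<le> (6 * l) ^ CARD('n)"
      using upper by (intro power_mono) auto
    then show ?thesis
      using a(1) by (simp add: emeasure_cube[OF l] emeasure_cube[OF shifted_cell_cube] power_mult_distrib
          ennreal_leI flip: ennreal_mult)
  qed
  ultimately show thesis
    using that[of "shifted_cell \<tau> k a" \<tau>] by (auto simp: shifted_grid_def)
qed

section \<open>Domination of the bilinear maximal function by dyadic ones\<close>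

definition grid_maximal ::
    "(real^'n::finite) set set \<Rightarrow> (real^'n \<Rightarrow> ennreal) \<Rightarrow> (real^'n \<Rightarrow> ennreal) \<Rightarrow> real^'n \<Rightarrow> ennreal" where
  "grid_maximal D f g x = (SUP Q\<in>D. average Q f * average Q g * indicator Q x)"

lemma average_le_average_superset:
  assumes "cube Q" "cube R" "Q \<subseteq> R" and le: "emeasure lebesgue R \<le> c * emeasure lebesgue Q"
  shows "average Q h \<le> c * average R h"
proof -
  have "(\<integral>\<^sup>+x\<in>Q. h x \<partial>lebesgue) \<le> (\<integral>\<^sup>+x\<in>R. h x \<partial>lebesgue)"
    using assms(3) by (intro nn_integral_mono) (auto split: split_indicator)
  also have "\<dots> = average R h * emeasure lebesgue R"
    by (rule average_times_measure[symmetric]) fact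
  also have "\<dots> \<le> average R h * (c * emeasure lebesgue Q)"
    by (intro mult_left_mono le) simp
  also have "\<dots> = emeasure lebesgue Q * (c * average R h)"
    by (simp add: ac_simps)
  finally show ?thesis
    unfolding average_def[of Q] using emeasure_cube_nonzero[OF assms(1)]
    by (intro divide_le_posI_ennreal) (auto simp: zero_less_iff_neq_zero)
qed

text \<open>Enlarging a cube to a grid cube costs 6^n in each of the two averages, hence 36^n. The
  grid depends on the cube, so the bound has to include all of them; their sum is easier to
  integrate than their maximum.\<close>

lemma bilinear_maximal_le_sum_grid_maximal:
  fixes f g :: "real^'n::finite \<Rightarrow> real"
  shows "bilinear_maximal f g x \<le> ennreal (36 ^ CARD('n)) *
    (\<Sum>\<tau>\<in>UNIV. grid_maximal (shifted_grid \<tau>) (\<lambda>y. ennreal \<bar>f y\<bar>) (\<lambda>y. ennreal \<bar>g y\<bar>) x)"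
  unfolding bilinear_maximal_def
proof (rule SUP_least, clarify)
  fix Q :: "(real^'n) set" assume "cube Q" "x \<in> Q"
  let ?f = "\<lambda>y. ennreal \<bar>f y\<bar>" and ?g = "\<lambda>y. ennreal \<bar>g y\<bar>"
  let ?c = "ennreal (6 ^ CARD('n))"
  obtain \<tau> R where R: "R \<in> shifted_grid \<tau>" "Q \<subseteq> R" "emeasure lebesgue R \<le> ?c * emeasure lebesgue Q"
    using cube_in_shifted_grid[OF \<open>cube Q\<close>] by blast
  have "cube R"
    using dyadic_grid_cube[OF dyadic_grid_shifted_grid R(1)] .
  have "average Q ?f * average Q ?g \<le> (?c * average R ?f) * (?c * average R ?g)"
    by (intro mult_mono average_le_average_superset R \<open>cube Q\<close> \<open>cube R\<close>) auto
  also have "\<dots> = ennreal (36 ^ CARD('n)) * (average R ?f * average R ?g * indicator R x)"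
  proof -
    have "?c * ?c = ennreal (36 ^ CARD('n))"
      by (simp flip: ennreal_mult power_mult_distrib)
    moreover have "x \<in> R"
      using \<open>x \<in> Q\<close> R by blast
    ultimately show ?thesis
      by (simp add: ac_simps flip: mult.assoc[of ?c ?c])
  qed
  also have "average R ?f * average R ?g * indicator R x \<le> grid_maximal (shifted_grid \<tau>) ?f ?g x"
    unfolding grid_maximal_def by (rule SUP_upper[OF R(1)])
  also have "grid_maximal (shifted_grid \<tau>) ?f ?g x \<le> (\<Sum>\<tau>\<in>UNIV. grid_maximal (shifted_grid \<tau>) ?f ?g x)"
    by (rule member_le_sum) auto
  finally show "average Q ?f * average Q ?g \<le> ennreal (36 ^ CARD('n)) *
      (\<Sum>\<tau>\<in>UNIV. grid_maximal (shifted_grid \<tau>) ?f ?g x)"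
    by (simp add: mult_left_mono)
qed

section \<open>Stopping cubes\<close>

text \<open>The cells of a fixed point, indexed by all integers, play the role of the chain of
  ancestors in the dyadic tree; the parent of a cell is the cell of the next level.\<close>

definition dyadic_cell :: "(real^'n::finite) set set \<Rightarrow> int \<Rightarrow> real^'n \<Rightarrow> (real^'n) set" where
  "dyadic_cell D k x = (THE Q. Q \<in> D \<and> cube_of_side (2 powi k) Q \<and> x \<in> Q)"

lemma dyadic_grid_level:
  assumes "dyadic_grid D"
  shows "partition_on UNIV {Q \<in> D. cube_of_side (2 powi k) Q}"
  using assms unfolding dyadic_grid_def by blast

lemma dyadic_grid_unique:
  assumes "dyadic_grid D" "Q \<in> D" "cube_of_side (2 powi k) Q" "x \<in> Q"
    "R \<in> D" "cube_of_side (2 powi k) R" "x \<in> R"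
  shows "Q = R"
proof (rule ccontr)
  assume "Q \<noteq> R"
  then have "disjnt Q R"
    using partition_onD2[OF dyadic_grid_level[OF assms(1), of k]] assms
    by (auto simp: pairwise_def disjoint_def disjnt_def)
  then show False
    using assms by (auto simp: disjnt_def)
qed

lemma
  assumes "dyadic_grid D"
  shows dyadic_cell_in_grid: "dyadic_cell D k x \<in> D"
    and dyadic_cell_side: "cube_of_side (2 powi k) (dyadic_cell D k x)"
    and in_dyadic_cell: "x \<in> dyadic_cell D k x"
proof -
  have "x \<in> \<Union>{Q \<in> D. cube_of_side (2 powi k) Q}"
    using partition_onD1[OF dyadic_grid_level[OF assms, of k]] by blast
  then have "\<exists>!Q. Q \<in> D \<and> cube_of_side (2 powi k) Q \<and> x \<in> Q"
    using dyadic_grid_unique[OF assms] by blast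
  from theI'[OF this] show "dyadic_cell D k x \<in> D" "cube_of_side (2 powi k) (dyadic_cell D k x)"
    "x \<in> dyadic_cell D k x"
    unfolding dyadic_cell_def by auto
qed

lemma dyadic_cell_eqI:
  assumes "dyadic_grid D" "Q \<in> D" "cube_of_side (2 powi k) Q" "x \<in> Q"
  shows "dyadic_cell D k x = Q"
  by (rule dyadic_grid_unique[OF assms(1) dyadic_cell_in_grid[OF assms(1)]
      dyadic_cell_side[OF assms(1)] in_dyadic_cell[OF assms(1)] assms(2-4)])

lemma dyadic_cell_eq:
  assumes "dyadic_grid D" "y \<in> dyadic_cell D k x"
  shows "dyadic_cell D k y = dyadic_cell D k x"
  by (rule dyadic_cell_eqI[OF assms(1) dyadic_cell_in_grid[OF assms(1)]
      dyadic_cell_side[OF assms(1)] assms(2)])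

lemma dyadic_grid_is_cell:
  assumes "dyadic_grid D" "Q \<in> D" "x \<in> Q"
  obtains k where "Q = dyadic_cell D k x"
proof -
  obtain k where "cube_of_side (2 powi k) Q"
    using assms unfolding dyadic_grid_def by blast
  then show thesis
    using that dyadic_cell_eqI[OF assms(1,2)] assms(3) by metis
qed

lemma emeasure_dyadic_cell:
  fixes D :: "(real^'n::finite) set set"
  assumes "dyadic_grid D"
  shows "emeasure lebesgue (dyadic_cell D k x) = ennreal ((2 powi k) ^ CARD('n))"
  by (rule emeasure_cube[OF dyadic_cell_side[OF assms]])

lemma lebesgue_measurable_dyadic_cell:
  "dyadic_grid D \<Longrightarrow> dyadic_cell D k x \<in> sets lebesgue"
  by (rule lebesgue_measurable_cube[OF dyadic_cell_side])

text \<open>Both cells contain \<open>x\<close>, so the grid axiom makes one a subset of the other;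
  comparing volumes rules out the wrong inclusion unless the levels coincide.\<close>

lemma dyadic_cell_mono:
  fixes D :: "(real^'n::finite) set set"
  assumes D: "dyadic_grid D" and "k \<le> l"
  shows "dyadic_cell D k x \<subseteq> dyadic_cell D l x"
proof (cases "dyadic_cell D l x \<subseteq> dyadic_cell D k x")
  case True
  then have "emeasure lebesgue (dyadic_cell D l x) \<le> emeasure lebesgue (dyadic_cell D k x)"
    by (rule emeasure_mono) (rule lebesgue_measurable_dyadic_cell[OF D])
  then have "(2 powi l :: real) ^ CARD('n) \<le> (2 powi k) ^ CARD('n)"
    by (simp add: emeasure_dyadic_cell[OF D])
  then have "(2 powi l :: real) \<le> 2 powi k"
    by (simp add: power_mono_iff)
  moreover have "(2 powi k :: real) \<le> 2 powi l"
    using \<open>k \<le> l\<close> by (intro power_int_increasing) auto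
  ultimately have "k = l"
    using two_powi_eq_iff[of k l] by simp
  then show ?thesis by simp
next
  case False
  have "\<forall>Q\<in>D. \<forall>R\<in>D. Q \<inter> R \<in> {Q, R, {}}"
    using D unfolding dyadic_grid_def by (elim conjE)
  then have "dyadic_cell D k x \<inter> dyadic_cell D l x \<in> {dyadic_cell D k x, dyadic_cell D l x, {}}"
    using dyadic_cell_in_grid[OF D] by (metis (no_types))
  moreover have "x \<in> dyadic_cell D k x \<inter> dyadic_cell D l x"
    using in_dyadic_cell[OF D] by blast
  ultimately show ?thesis
    using False by blast
qed

lemma countable_dyadic_grid:
  assumes "dyadic_grid D"
  shows "countable D"
proof -
  have "countable {Q \<in> D. cube_of_side (2 powi k) Q}" for k
    using partition_onD2[OF dyadic_grid_level[OF assms, of k]]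
    by (rule countable_disjoint_cubes) (auto simp: cube_def)
  then have "countable (\<Union>k::int. {Q \<in> D. cube_of_side (2 powi k) Q})"
    by (intro countable_UN) auto
  moreover have "D \<subseteq> (\<Union>k::int. {Q \<in> D. cube_of_side (2 powi k) Q})"
    using assms unfolding dyadic_grid_def by blast
  ultimately show ?thesis
    by (rule countable_subset[rotated])
qed

text \<open>These are the maximal grid cubes with \<open>\<phi> > t\<close>: the condition on
  \<open>j > k\<close> says that every proper ancestor fails. The set function stays abstract, since
  nesting and disjointness use only its comparison with the threshold.\<close>

definition stopping_cubes ::
    "(real^'n::finite) set set \<Rightarrow> ((real^'n) set \<Rightarrow> ennreal) \<Rightarrow> ennreal \<Rightarrow> (real^'n) set set" where
  "stopping_cubes D \<phi> t = {dyadic_cell D k x | k x.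
    t < \<phi> (dyadic_cell D k x) \<and> (\<forall>j>k. \<phi> (dyadic_cell D j x) \<le> t)}"

text \<open>The base point in the definition can be exchanged for any point of the cube, because two
  points of a cell have the same ancestors from that level on.\<close>

lemma stopping_cubesE:
  assumes "dyadic_grid D" "Q \<in> stopping_cubes D \<phi> t" "y \<in> Q"
  obtains k where "Q = dyadic_cell D k y" "t < \<phi> Q" "\<And>j. k < j \<Longrightarrow> \<phi> (dyadic_cell D j y) \<le> t"
proof -
  obtain k x where Q: "Q = dyadic_cell D k x" "t < \<phi> Q" "\<forall>j>k. \<phi> (dyadic_cell D j x) \<le> t"
    using assms(2) unfolding stopping_cubes_def by blast
  have "dyadic_cell D j y = dyadic_cell D j x" if "k \<le> j" for j
    using assms(3) Q(1) dyadic_cell_mono[OF assms(1) that, of x] dyadic_cell_eq[OF assms(1)] by blast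
  then show thesis
    using Q that[of k] by auto
qed

lemma stopping_cubes_subset: "dyadic_grid D \<Longrightarrow> stopping_cubes D \<phi> t \<subseteq> D"
  unfolding stopping_cubes_def using dyadic_cell_in_grid by blast

text \<open>\<open>R\<close> satisfies \<open>\<phi> R > s \<ge> t\<close>, so it cannot be a proper
  ancestor of \<open>Q\<close>, all of which have value at most \<open>t\<close>. With equal
  thresholds, applied in both directions, this gives disjointness.\<close>

lemma stopping_cubes_nested:
  assumes D: "dyadic_grid D" and "t \<le> s"
    and Q: "Q \<in> stopping_cubes D \<phi> t" and R: "R \<in> stopping_cubes D \<phi> s" and "Q \<inter> R \<noteq> {}"
  shows "R \<subseteq> Q"
proof -
  obtain y where y: "y \<in> Q" "y \<in> R"
    using assms by blast
  obtain k where k: "Q = dyadic_cell D k y" "\<And>j. k < j \<Longrightarrow> \<phi> (dyadic_cell D j y) \<le> t"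
    using stopping_cubesE[OF D Q y(1)] by metis
  obtain l where l: "R = dyadic_cell D l y" "s < \<phi> R"
    using stopping_cubesE[OF D R y(2)] by metis
  have "\<not> k < l"
    using k(2)[of l] l \<open>t \<le> s\<close> by auto
  then show ?thesis
    using dyadic_cell_mono[OF D, of l k y] k(1) l(1) by auto
qed

lemma disjoint_stopping_cubes:
  assumes "dyadic_grid D"
  shows "disjoint (stopping_cubes D \<phi> t)"
proof (rule disjointI)
  fix Q R
  assume "Q \<in> stopping_cubes D \<phi> t" "R \<in> stopping_cubes D \<phi> t" "Q \<noteq> R"
  then show "Q \<inter> R = {}"
    using stopping_cubes_nested[OF assms order_refl, of Q \<phi> t R]
      stopping_cubes_nested[OF assms order_refl, of R \<phi> t Q] by blast
qed

text \<open>The levels from \<open>k\<close> on at which the cell of \<open>x\<close> exceeds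
  \<open>t\<close> form a nonempty finite set, and its maximum is the level of the stopping cube.
  Without the bound \<open>K\<close> there could be an infinite increasing chain and no maximal
  cube.\<close>

lemma stopping_cubes_cover:
  assumes "t < \<phi> (dyadic_cell D k x)" and bound: "\<And>j. K < j \<Longrightarrow> \<phi> (dyadic_cell D j x) \<le> t"
    and D: "dyadic_grid D"
  obtains Q where "Q \<in> stopping_cubes D \<phi> t" "x \<in> Q" "t < \<phi> Q"
proof -
  define A where "A = {j. k \<le> j \<and> t < \<phi> (dyadic_cell D j x)}"
  have "k \<in> A"
    using assms(1) by (simp add: A_def)
  have "A \<subseteq> {k..K}"
    using bound unfolding A_def by (force simp: not_less[symmetric])
  then have "finite A"
    by (rule finite_subset) simp
  let ?j = "Max A"
  have "?j \<in> A"
    using \<open>finite A\<close> \<open>k \<in> A\<close> by (intro Max_in) auto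
  have "\<phi> (dyadic_cell D i x) \<le> t" if "?j < i" for i
  proof (rule ccontr)
    assume "\<not> \<phi> (dyadic_cell D i x) \<le> t"
    then have "i \<in> A"
      using that \<open>?j \<in> A\<close> by (auto simp: A_def)
    then show False
      using that Max_ge[OF \<open>finite A\<close>, of i] by simp
  qed
  then show thesis
    using \<open>?j \<in> A\<close> in_dyadic_cell[OF D] by (intro that[of "dyadic_cell D ?j x"]) (auto simp: A_def stopping_cubes_def)
qed

section \<open>Products of averages and the sparseness of their stopping cubes\<close>

definition average_product :: "(real^'n::finite \<Rightarrow> ennreal) \<Rightarrow> (real^'n \<Rightarrow> ennreal) \<Rightarrow> (real^'n) set \<Rightarrow> ennreal" where
  "average_product f g Q = average Q f * average Q g"

lemma average_dyadic_cell:
  fixes D :: "(real^'n::finite) set set"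
  assumes "dyadic_grid D"
    and "(\<integral>\<^sup>+x\<in>dyadic_cell D k x. h x \<partial>lebesgue) = ennreal H" "0 \<le> H"
  shows "average (dyadic_cell D k x) h = ennreal (H / (2 powi k) ^ CARD('n))"
  unfolding average_def emeasure_dyadic_cell[OF assms(1)] assms(2)
  using assms(3) by (simp add: divide_ennreal)

lemma set_nn_integral_finite:
  fixes h :: "real^'n::finite \<Rightarrow> ennreal"
  assumes "(\<integral>\<^sup>+x. h x \<partial>lebesgue) < \<infinity>"
  obtains H where "0 \<le> H" "(\<integral>\<^sup>+x\<in>A. h x \<partial>lebesgue) = ennreal H"
proof -
  have "(\<integral>\<^sup>+x\<in>A. h x \<partial>lebesgue) \<le> (\<integral>\<^sup>+x. h x \<partial>lebesgue)"
    by (intro nn_integral_mono) (auto split: split_indicator)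
  then have "(\<integral>\<^sup>+x\<in>A. h x \<partial>lebesgue) < top"
    using assms by (simp add: le_less_trans)
  then show thesis
    using that by (cases "\<integral>\<^sup>+x\<in>A. h x \<partial>lebesgue") auto
qed

text \<open>With F, G the total integrals, the product over a cell of level j is at most FG /
  4^(jn), which tends to 0. This supplies the bound on levels that
  \<open>stopping_cubes_cover\<close> requires.\<close>

lemma average_product_large_cells:
  fixes D :: "(real^'n::finite) set set"
  assumes D: "dyadic_grid D" and fin: "(\<integral>\<^sup>+x. f x \<partial>lebesgue) < \<infinity>" "(\<integral>\<^sup>+x. g x \<partial>lebesgue) < \<infinity>"
    and "0 < t"
  obtains K where "\<And>j. K < j \<Longrightarrow> average_product f g (dyadic_cell D j x) \<le> ennreal t"
proof -
  obtain F where F: "0 \<le> F" "(\<integral>\<^sup>+x. f x \<partial>lebesgue) = ennreal F"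
    using fin(1) by (cases "\<integral>\<^sup>+x. f x \<partial>lebesgue") auto
  obtain G where G: "0 \<le> G" "(\<integral>\<^sup>+x. g x \<partial>lebesgue) = ennreal G"
    using fin(2) by (cases "\<integral>\<^sup>+x. g x \<partial>lebesgue") auto
  obtain N :: nat where N: "F * G / t < 2 ^ N"
    using real_arch_pow[of 2 "F * G / t"] by auto
  have "average_product f g (dyadic_cell D j x) \<le> ennreal t" if "int N < j" for j
  proof -
    let ?Q = "dyadic_cell D j x"
    let ?m = "(2 powi j :: real) ^ CARD('n)"
    obtain F' where F': "0 \<le> F'" "(\<integral>\<^sup>+x\<in>?Q. f x \<partial>lebesgue) = ennreal F'"
      using set_nn_integral_finite[OF fin(1)] by metis
    obtain G' where G': "0 \<le> G'" "(\<integral>\<^sup>+x\<in>?Q. g x \<partial>lebesgue) = ennreal G'"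
      using set_nn_integral_finite[OF fin(2)] by metis
    have "ennreal F' \<le> ennreal F"
      unfolding F'(2)[symmetric] F(2)[symmetric] by (intro nn_integral_mono) (auto split: split_indicator)
    then have "F' \<le> F"
      using F by simp
    have "ennreal G' \<le> ennreal G"
      unfolding G'(2)[symmetric] G(2)[symmetric] by (intro nn_integral_mono) (auto split: split_indicator)
    then have "G' \<le> G"
      using G by simp
    have one: "1 \<le> (2 powi j :: real)"
      using that by (intro one_le_power_int) auto
    have "(2::real) ^ N = 2 powi (int N)"
      by simp
    also have "\<dots> \<le> 2 powi j"
      using that by (intro power_int_increasing) auto
    also have "\<dots> \<le> ?m"
      using one by (intro self_le_power) auto
    also have "\<dots> \<le> ?m * ?m"
      using one_le_power[OF one, of "CARD('n)"] mult_left_mono[of 1 ?m ?m] by simp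
    finally have "F * G / t \<le> ?m * ?m"
      using N by simp
    moreover have "F' * G' \<le> F * G"
      using \<open>F' \<le> F\<close> \<open>G' \<le> G\<close> F' G' by (intro mult_mono) auto
    ultimately have "(F' / ?m) * (G' / ?m) \<le> t"
      using \<open>0 < t\<close> by (simp add: field_simps)
    then show ?thesis
      using F'(1) G'(1) by (simp add: average_product_def average_dyadic_cell[OF D F'(2,1)]
          average_dyadic_cell[OF D G'(2,1)] ennreal_leI flip: ennreal_mult)
  qed
  then show thesis
    using that by blast
qed

text \<open>
  The measure with density \<open>c f + d g\<close>, for \<open>c = |Q| / (4 \<integral>\<^sub>Q f)\<close> and \<open>d = |Q| / (4 \<integral>\<^sub>Q g)\<close>, gives
  \<open>Q\<close> the mass \<open>|Q|/2\<close>; by AM-GM it gives every stopping cube of the next level inside \<open>Q\<close> at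
  least its Lebesgue measure.
\<close>

lemma stopping_cube_AM_GM:
  fixes F G F' G' m m' s :: real
  assumes pos: "0 < F" "0 < G" "0 < m" "0 < m'" "0 \<le> F'" "0 \<le> G'" "0 < s"
    and small: "4 * (F * G) \<le> s * (m * m)" and large: "s * (m' * m') \<le> F' * G'"
  shows "m' \<le> m / (4 * F) * F' + m / (4 * G) * G'"
proof -
  have amgm: "4 * a * b \<le> (a + b)\<^sup>2" for a b :: real
    using sum_squares_bound[of a b] by (simp add: power2_sum)
  let ?a = "m / (4 * F) * F'" and ?b = "m / (4 * G) * G'"
  have "m' * m' * (4 * (F * G)) \<le> m' * m' * (s * (m * m))"
    using small by (intro mult_left_mono) auto
  also have "\<dots> = s * (m' * m') * (m * m)"
    by simp
  also have "\<dots> \<le> F' * G' * (m * m)"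
    using large by (intro mult_right_mono) auto
  finally have "m' * m' \<le> (F' * G' * (m * m)) / (4 * (F * G))"
    using pos by (simp add: pos_le_divide_eq)
  also have "\<dots> = 4 * ?a * ?b"
    using pos by (simp add: field_simps)
  also have "\<dots> \<le> (?a + ?b)\<^sup>2"
    by (rule amgm)
  finally have "m'\<^sup>2 \<le> (?a + ?b)\<^sup>2"
    by (simp add: power2_eq_square)
  then show ?thesis
    by (rule power2_le_imp_le) (use pos in simp)
qed

text \<open>Of the factor 4^(n+1) between the thresholds, 4^n absorbs the passage from the parent of
  \<open>Q\<close> to \<open>Q\<close>; the remaining 4 is what \<open>stopping_cube_AM_GM\<close>
  needs in order to compare each smaller cube with a measure of mass |Q|/2 on
  \<open>Q\<close>.\<close>

lemma stopping_cubes_sparse: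
  fixes D :: "(real^'n::finite) set set"
  assumes D: "dyadic_grid D"
    and [measurable]: "f \<in> borel_measurable lebesgue" "g \<in> borel_measurable lebesgue"
    and fin: "(\<integral>\<^sup>+x. f x \<partial>lebesgue) < \<infinity>" "(\<integral>\<^sup>+x. g x \<partial>lebesgue) < \<infinity>"
    and "0 < t"
    and Q: "Q \<in> stopping_cubes D (average_product f g) (ennreal t)"
  shows "emeasure lebesgue (\<Union>(stopping_cubes D (average_product f g) (ennreal (4 ^ (CARD('n) + 1) * t))) \<inter> Q)
    \<le> emeasure lebesgue Q / 2"
proof -
  let ?\<phi> = "average_product f g"
  define s where "s = 4 ^ (CARD('n) + 1) * t"
  have "0 < s"
    using \<open>0 < t\<close> by (simp add: s_def)
  have "ennreal t \<le> ennreal s"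
    using \<open>0 < t\<close> one_le_power[of "4::real" "CARD('n) + 1"] by (auto simp: s_def intro!: ennreal_leI)
  let ?S = "stopping_cubes D ?\<phi> (ennreal s)"
  obtain k x where k: "Q = dyadic_cell D k x" "ennreal t < ?\<phi> Q" "?\<phi> (dyadic_cell D (k + 1) x) \<le> ennreal t"
    using Q unfolding stopping_cubes_def by fastforce
  let ?P = "dyadic_cell D (k + 1) x"
  define m :: real where "m = (2 powi k) ^ CARD('n)"
  have "0 < m"
    by (simp add: m_def)
  have mP: "(2 powi (k + 1) :: real) ^ CARD('n) = 2 ^ CARD('n) * m"
    by (simp add: m_def power_int_add power_mult_distrib)
  have "Q \<subseteq> ?P"
    unfolding k(1) by (rule dyadic_cell_mono[OF D]) simp
  have Qm[measurable]: "Q \<in> sets lebesgue"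
    unfolding k(1) by (rule lebesgue_measurable_dyadic_cell[OF D])
  have Q_meas: "emeasure lebesgue Q = ennreal m"
    by (simp add: k(1) emeasure_dyadic_cell[OF D] m_def)
  obtain F where F: "0 \<le> F" "(\<integral>\<^sup>+x\<in>Q. f x \<partial>lebesgue) = ennreal F"
    using set_nn_integral_finite[OF fin(1)] by metis
  obtain G where G: "0 \<le> G" "(\<integral>\<^sup>+x\<in>Q. g x \<partial>lebesgue) = ennreal G"
    using set_nn_integral_finite[OF fin(2)] by metis
  obtain F1 where F1: "0 \<le> F1" "(\<integral>\<^sup>+x\<in>?P. f x \<partial>lebesgue) = ennreal F1"
    using set_nn_integral_finite[OF fin(1)] by metis
  obtain G1 where G1: "0 \<le> G1" "(\<integral>\<^sup>+x\<in>?P. g x \<partial>lebesgue) = ennreal G1"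
    using set_nn_integral_finite[OF fin(2)] by metis
  have mono: "(\<integral>\<^sup>+x\<in>A. h x \<partial>lebesgue) \<le> (\<integral>\<^sup>+x\<in>B. h x \<partial>lebesgue)" if "A \<subseteq> B" for A B and h :: "real^'n \<Rightarrow> ennreal"
    using that by (intro nn_integral_mono) (auto split: split_indicator)
  have "F \<le> F1" "G \<le> G1"
    using mono[OF \<open>Q \<subseteq> ?P\<close>, of f] mono[OF \<open>Q \<subseteq> ?P\<close>, of g] F F1 G G1 by simp_all
  have avg: "?\<phi> Q = ennreal (F / m * (G / m))"
    unfolding average_product_def k(1)
    using F G by (simp add: average_dyadic_cell[OF D F(2)[unfolded k(1)] F(1)]
        average_dyadic_cell[OF D G(2)[unfolded k(1)] G(1)] m_def flip: ennreal_mult)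
  have "t < F / m * (G / m)"
    using k(2) \<open>0 < t\<close> unfolding avg by (simp add: ennreal_less_iff)
  \<comment> \<open>Both integrals over \<open>Q\<close> appear as denominators in the density
    below.\<close>
  then have "F \<noteq> 0" "G \<noteq> 0"
    using \<open>0 < t\<close> by auto
  then have "0 < F" "0 < G"
    using F G by auto
  have "?\<phi> ?P = ennreal (F1 / (2 ^ CARD('n) * m) * (G1 / (2 ^ CARD('n) * m)))"
    unfolding average_product_def
    using F1 G1 \<open>0 < m\<close> by (simp add: average_dyadic_cell[OF D F1(2,1)] average_dyadic_cell[OF D G1(2,1)] mP
        flip: ennreal_mult)
  then have "F1 / (2 ^ CARD('n) * m) * (G1 / (2 ^ CARD('n) * m)) \<le> t"
    using k(3) \<open>0 < t\<close> by simp
  \<comment> \<open>The parent violates the threshold, and its volume is 2^n times that of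
    \<open>Q\<close>; squaring gives the factor 4^n.\<close>
  then have "F1 * G1 \<le> t * ((2 ^ CARD('n) * m) * (2 ^ CARD('n) * m))"
    using \<open>0 < m\<close> by (simp add: pos_divide_le_eq)
  also have "\<dots> = t * (4 ^ CARD('n)) * (m * m)"
    by (simp add: power_mult_distrib[symmetric] algebra_simps)
  finally have "4 * (F1 * G1) \<le> s * (m * m)"
    by (simp add: s_def algebra_simps)
  moreover have "F * G \<le> F1 * G1"
    using \<open>F \<le> F1\<close> \<open>G \<le> G1\<close> F G by (intro mult_mono) auto
  ultimately have small: "4 * (F * G) \<le> s * (m * m)"
    by simp
  define c d where "c = m / (4 * F)" and "d = m / (4 * G)"
  have "0 \<le> c" "0 \<le> d"
    using \<open>0 < m\<close> \<open>0 < F\<close> \<open>0 < G\<close> by (auto simp: c_def d_def)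
  define \<nu> where "\<nu> = density lebesgue (\<lambda>x. ennreal c * f x + ennreal d * g x)"
  have \<nu>: "emeasure \<nu> A = ennreal c * (\<integral>\<^sup>+x\<in>A. f x \<partial>lebesgue) + ennreal d * (\<integral>\<^sup>+x\<in>A. g x \<partial>lebesgue)"
    if [measurable]: "A \<in> sets lebesgue" for A
  proof -
    have "emeasure \<nu> A = (\<integral>\<^sup>+x. ennreal c * (f x * indicator A x) + ennreal d * (g x * indicator A x) \<partial>lebesgue)"
      unfolding \<nu>_def by (subst emeasure_density) (auto intro!: nn_integral_cong simp: algebra_simps)
    then show ?thesis
      by (simp add: nn_integral_add nn_integral_cmult)
  qed
  have \<nu>Q: "emeasure \<nu> Q = ennreal (m / 2)"
  proof -
    have "emeasure \<nu> Q = ennreal (c * F + d * G)"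
      using F G \<open>0 \<le> c\<close> \<open>0 \<le> d\<close> by (simp add: \<nu> flip: ennreal_mult ennreal_plus)
    also have "c * F + d * G = m / 2"
      using \<open>0 < F\<close> \<open>0 < G\<close> by (simp add: c_def d_def)
    finally show ?thesis .
  qed
  define I where "I = {R \<in> ?S. R \<subseteq> Q}"
  \<comment> \<open>By nesting, every cube of the next level that meets \<open>Q\<close> is
    contained in \<open>Q\<close>, so the intersection is a disjoint union of whole cubes.\<close>
  have W: "\<Union>?S \<inter> Q = \<Union>((\<lambda>R. R) ` I)"
    using stopping_cubes_nested[OF D \<open>ennreal t \<le> ennreal s\<close> Q] by (auto simp: I_def)
  have "countable I"
    by (rule countable_subset[OF _ countable_dyadic_grid[OF D]])
      (use stopping_cubes_subset[OF D] in \<open>auto simp: I_def\<close>)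
  have disj: "disjoint_family_on (\<lambda>R. R) I"
    using disjoint_stopping_cubes[OF D] unfolding disjoint_family_on_def disjoint_def I_def by blast
  have Im: "R \<in> sets lebesgue" if "R \<in> I" for R
    using that lebesgue_measurable_dyadic_cell[OF D] by (auto simp: I_def stopping_cubes_def)
  have small_cube: "emeasure lebesgue R \<le> emeasure \<nu> R" if "R \<in> I" for R
  proof -
    obtain j y where j: "R = dyadic_cell D j y" "ennreal s < ?\<phi> R"
      using \<open>R \<in> I\<close> unfolding I_def stopping_cubes_def by blast
    define m' :: real where "m' = (2 powi j) ^ CARD('n)"
    have "0 < m'"
      by (simp add: m'_def)
    have R_meas: "emeasure lebesgue R = ennreal m'"
      by (simp add: j(1) emeasure_dyadic_cell[OF D] m'_def)
    obtain F' where F': "0 \<le> F'" "(\<integral>\<^sup>+x\<in>R. f x \<partial>lebesgue) = ennreal F'"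
      using set_nn_integral_finite[OF fin(1)] by metis
    obtain G' where G': "0 \<le> G'" "(\<integral>\<^sup>+x\<in>R. g x \<partial>lebesgue) = ennreal G'"
      using set_nn_integral_finite[OF fin(2)] by metis
    have "?\<phi> R = ennreal (F' / m' * (G' / m'))"
      unfolding average_product_def j(1)
      using F' G' by (simp add: average_dyadic_cell[OF D F'(2)[unfolded j(1)] F'(1)]
          average_dyadic_cell[OF D G'(2)[unfolded j(1)] G'(1)] m'_def flip: ennreal_mult)
    then have "s < F' / m' * (G' / m')"
      using j(2) \<open>0 < s\<close> by (simp add: ennreal_less_iff)
    then have "s * (m' * m') \<le> F' * G'"
      using \<open>0 < m'\<close> by (simp add: pos_less_divide_eq)
    then have "m' \<le> c * F' + d * G'"
      unfolding c_def d_def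
      using \<open>0 < F\<close> \<open>0 < G\<close> \<open>0 < m\<close> \<open>0 < m'\<close> \<open>0 < s\<close> F' G' small by (intro stopping_cube_AM_GM) auto
    then show ?thesis
      using F' G' \<open>0 \<le> c\<close> \<open>0 \<le> d\<close> Im[OF that]
      by (simp add: R_meas \<nu> ennreal_leI flip: ennreal_mult ennreal_plus)
  qed
  \<comment> \<open>Cube by cube, Lebesgue measure is at most \<nu>; countable additivity of both
    measures reduces the claim to the mass of \<open>Q\<close> under \<nu>.\<close>
  have "emeasure lebesgue (\<Union>?S \<inter> Q) = (\<integral>\<^sup>+R. emeasure lebesgue R \<partial>count_space I)"
    unfolding W using Im \<open>countable I\<close> disj by (rule emeasure_UN_countable)
  also have "\<dots> \<le> (\<integral>\<^sup>+R. emeasure \<nu> R \<partial>count_space I)"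
    using small_cube by (intro nn_integral_mono) simp
  also have "\<dots> = emeasure \<nu> (\<Union>((\<lambda>R. R) ` I))"
    using Im \<open>countable I\<close> disj by (intro emeasure_UN_countable[symmetric]) (auto simp: \<nu>_def)
  also have "\<dots> \<le> emeasure \<nu> Q"
    using Qm by (intro emeasure_mono) (auto simp: I_def \<nu>_def)
  also have "\<dots> = emeasure lebesgue Q / 2"
    using divide_ennreal[of m 2] \<open>0 < m\<close> by (simp add: \<nu>Q Q_meas)
  finally show ?thesis
    by (simp add: s_def)
qed

section \<open>Sparse domination of the dyadic maximal operator\<close>

text \<open>Consecutive thresholds differ by exactly the factor of
  \<open>stopping_cubes_sparse\<close>. A cube selected for a larger threshold also exceeds the
  smaller one, hence lies in a maximal cube for it; this gives the inclusion of consecutive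
  levels.\<close>

lemma sparse_family_stopping_cubes:
  fixes D :: "(real^'n::finite) set set"
  assumes D: "dyadic_grid D"
    and meas: "f \<in> borel_measurable lebesgue" "g \<in> borel_measurable lebesgue"
    and fin: "(\<integral>\<^sup>+x. f x \<partial>lebesgue) < \<infinity>" "(\<integral>\<^sup>+x. g x \<partial>lebesgue) < \<infinity>"
  shows "sparse_family D UNIV
    (\<lambda>k. stopping_cubes D (average_product f g) (ennreal ((4 ^ (CARD('n) + 1)) powi k)))"
proof -
  let ?\<phi> = "average_product f g"
  define a :: real where "a = 4 ^ (CARD('n) + 1)"
  let ?S = "\<lambda>k. stopping_cubes D ?\<phi> (ennreal (a powi k))"
  have "1 < a"
    unfolding a_def by (rule one_less_power) auto
  then have pos: "0 < a powi k" for k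
    by simp
  have "\<Union>(?S (k + 1)) \<subseteq> \<Union>(?S k)" for k
  proof
    fix x assume "x \<in> \<Union>(?S (k + 1))"
    then obtain R where R: "R \<in> ?S (k + 1)" "x \<in> R" by blast
    obtain l where l: "R = dyadic_cell D l x" "ennreal (a powi (k + 1)) < ?\<phi> R"
      using stopping_cubesE[OF D R] by metis
    have "ennreal (a powi k) \<le> ennreal (a powi (k + 1))"
      using \<open>1 < a\<close> by (intro ennreal_leI power_int_increasing) auto
    also have "\<dots> < ?\<phi> (dyadic_cell D l x)"
      using l by simp
    finally have 1: "ennreal (a powi k) < ?\<phi> (dyadic_cell D l x)" .
    obtain K where K: "\<And>j. K < j \<Longrightarrow> ?\<phi> (dyadic_cell D j x) \<le> ennreal (a powi k)"
      using average_product_large_cells[OF D fin pos] by blast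
    obtain Q where "Q \<in> ?S k" "x \<in> Q"
      by (rule stopping_cubes_cover[where \<phi> = "?\<phi>" and k = l and K = K and x = x, OF 1 K D])
    then show "x \<in> \<Union>(?S k)"
      by blast
  qed
  moreover have "emeasure lebesgue (\<Union>(?S (k + 1)) \<inter> Q) \<le> emeasure lebesgue Q / 2" if "Q \<in> ?S k" for k Q
  proof -
    have "a powi (k + 1) = a * a powi k"
      using \<open>1 < a\<close> by (simp add: power_int_add)
    then show ?thesis
      using stopping_cubes_sparse[OF D meas fin pos that] by (simp only: a_def)
  qed
  ultimately show ?thesis
    unfolding sparse_family_def a_def[symmetric]
    by (simp only: disjoint_stopping_cubes[OF D] stopping_cubes_subset[OF D] subset_UNIV) simp
qed

lemma average_le:
  assumes "cube Q" "\<And>x. h x \<le> c"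
  shows "average Q h \<le> c"
proof -
  have "(\<integral>\<^sup>+x\<in>Q. h x \<partial>lebesgue) \<le> (\<integral>\<^sup>+x\<in>Q. c \<partial>lebesgue)"
    using assms(2) by (simp add: nn_integral_mono mult_right_mono)
  also have "\<dots> = emeasure lebesgue Q * c"
    using cube_in_sets_lebesgue[OF assms(1)] by (simp add: nn_integral_cmult_indicator mult.commute)
  finally show ?thesis
    unfolding average_def using emeasure_cube_nonzero[OF assms(1)]
    by (intro divide_le_posI_ennreal) (auto simp: zero_less_iff_neq_zero)
qed

text \<open>One term of the sum is enough: if the maximal function at \<open>x\<close> lies between
  \<open>a^k\<close> and \<open>a^(k+1)\<close>, then some stopping cube of level \<open>k\<close>
  contains \<open>x\<close>, and its product of averages exceeds \<open>a^k\<close>. Bounded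
  functions keep the maximal function finite, so such a \<open>k\<close> exists whenever the value
  is positive.\<close>

lemma grid_maximal_le_sparse_sum:
  fixes D :: "(real^'n::finite) set set"
  assumes D: "dyadic_grid D"
    and fin: "(\<integral>\<^sup>+x. f x \<partial>lebesgue) < \<infinity>" "(\<integral>\<^sup>+x. g x \<partial>lebesgue) < \<infinity>"
    and bdd: "\<And>x. f x \<le> ennreal b" "\<And>x. g x \<le> ennreal b"
    and a: "1 < a"
  defines "S \<equiv> \<lambda>k. stopping_cubes D (average_product f g) (ennreal (a powi k))"
  shows "grid_maximal D f g x \<le>
    ennreal a * (\<integral>\<^sup>+i. average_product f g (snd i) * indicator (snd i) x \<partial>count_space (SIGMA k:UNIV. S k))"
proof -
  let ?\<phi> = "average_product f g"
  have M: "grid_maximal D f g x = (SUP Q\<in>D. ?\<phi> Q * indicator Q x)"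
    by (simp add: grid_maximal_def average_product_def)
  have "grid_maximal D f g x \<le> ennreal b * ennreal b"
    unfolding M average_product_def
    using average_le[OF dyadic_grid_cube[OF D]] bdd
    by (intro SUP_least) (auto simp: indicator_def intro!: mult_mono)
  also have "\<dots> < top"
    by (simp add: ennreal_mult_less_top)
  finally obtain y where y: "0 \<le> y" "grid_maximal D f g x = ennreal y"
    by (cases "grid_maximal D f g x") auto
  show ?thesis
  proof (cases "y = 0")
    case True
    then show ?thesis by (simp add: y)
  next
    case False
    then have "0 < y" using y by simp
    \<comment> \<open>The ceiling minus one makes the lower inequality strict, so that some cube in
      the supremum exceeds \<open>a powi k\<close>; the upper inequality may be an equality.\<close>
    define k :: int where "k = \<lceil>log a y\<rceil> - 1"
    have powi: "a powi j = a powr real_of_int j" for j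
      using a by (simp add: powr_real_of_int')
    have y_eq: "y = a powr (log a y)"
      using a \<open>0 < y\<close> by simp
    have "real_of_int k < log a y" "log a y \<le> real_of_int (k + 1)"
      unfolding k_def by linarith+
    then have k: "a powi k < y" "y \<le> a powi (k + 1)"
      unfolding powi using a by (subst y_eq, simp)+
    have pos: "0 < a powi k"
      using a by simp
    have "ennreal (a powi k) < (SUP Q\<in>D. ?\<phi> Q * indicator Q x)"
      using k(1) y pos unfolding M[symmetric] by (simp add: ennreal_less_iff)
    then obtain Q where Q: "Q \<in> D" "ennreal (a powi k) < ?\<phi> Q * indicator Q x"
      by (auto simp: less_SUP_iff)
    then have "x \<in> Q" "ennreal (a powi k) < ?\<phi> Q"
      by (cases "x \<in> Q"; simp)+
    then obtain l where l: "ennreal (a powi k) < ?\<phi> (dyadic_cell D l x)"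
      using dyadic_grid_is_cell[OF D Q(1)] by metis
    obtain K where K: "\<And>j. K < j \<Longrightarrow> ?\<phi> (dyadic_cell D j x) \<le> ennreal (a powi k)"
      using average_product_large_cells[OF D fin pos] by blast
    obtain R where R: "R \<in> S k" "x \<in> R" "ennreal (a powi k) < ?\<phi> R"
      unfolding S_def by (rule stopping_cubes_cover[where \<phi> = "?\<phi>" and k = l and K = K and x = x, OF l K D])
    have "ennreal y \<le> ennreal (a * a powi k)"
      using k(2) a by (intro ennreal_leI) (simp add: power_int_add mult.commute)
    also have "\<dots> = ennreal a * ennreal (a powi k)"
      using a by (simp add: ennreal_mult)
    also have "\<dots> \<le> ennreal a * (?\<phi> (snd (k, R)) * indicator (snd (k, R)) x)"
      using R by (intro mult_left_mono) auto
    also have "\<dots> \<le> ennreal a * (\<integral>\<^sup>+i. ?\<phi> (snd i) * indicator (snd i) x \<partial>count_space (SIGMA k:UNIV. S k))"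
      using R(1) by (intro mult_left_mono nn_integral_ge_point) auto
    finally show ?thesis
      by (simp add: y)
  qed
qed

text \<open>Integrating the pointwise bound gives the sum of f_Q g_Q |Q|, which is also the value of
  the bilinear form of the sparse operator. The family is built from \<open>f\<close> and
  \<open>g\<close>, hence the existential conclusion.\<close>

lemma nn_integral_grid_maximal_le_sparse_op:
  fixes D :: "(real^'n::finite) set set" and f g :: "real^'n \<Rightarrow> real"
  assumes D: "dyadic_grid D"
    and [measurable]: "f \<in> borel_measurable lebesgue" "g \<in> borel_measurable lebesgue"
    and fin: "(\<integral>\<^sup>+x. ennreal (f x) \<partial>lebesgue) < \<infinity>" "(\<integral>\<^sup>+x. ennreal (g x) \<partial>lebesgue) < \<infinity>"
    and bdd: "\<And>x. f x \<le> b" "\<And>x. g x \<le> b"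
  obtains S where "sparse_family D UNIV S"
    "(\<integral>\<^sup>+x. grid_maximal D (\<lambda>x. ennreal (f x)) (\<lambda>x. ennreal (g x)) x \<partial>lebesgue)
      \<le> ennreal (4 ^ (CARD('n) + 1)) * (\<integral>\<^sup>+x. sparse_op UNIV S f x * ennreal (g x) \<partial>lebesgue)"
proof -
  let ?a = "4 ^ (CARD('n) + 1) :: real"
  let ?f = "\<lambda>x. ennreal (f x)" and ?g = "\<lambda>x. ennreal (g x)"
  let ?\<phi> = "average_product ?f ?g"
  define S where "S = (\<lambda>k. stopping_cubes D ?\<phi> (ennreal (?a powi k)))"
  let ?I = "SIGMA k:UNIV. S k"
  have S: "sparse_family D UNIV S"
    unfolding S_def using fin by (intro sparse_family_stopping_cubes[OF D]) auto
  note cube = measurable_sparse_cube[OF D S]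
  note count = countable_sparse_family[OF D S]
  have "1 < ?a"
    by (rule one_less_power) auto
  then have "(\<integral>\<^sup>+x. grid_maximal D ?f ?g x \<partial>lebesgue)
      \<le> (\<integral>\<^sup>+x. ennreal ?a * (\<integral>\<^sup>+i. ?\<phi> (snd i) * indicator (snd i) x \<partial>count_space ?I) \<partial>lebesgue)"
    unfolding S_def using fin bdd
    by (intro nn_integral_mono grid_maximal_le_sparse_sum[OF D, where b = b]) (auto intro: ennreal_leI)
  also have "\<dots> = ennreal ?a * (\<integral>\<^sup>+x. (\<integral>\<^sup>+i. ?\<phi> (snd i) * indicator (snd i) x \<partial>count_space ?I) \<partial>lebesgue)"
    using cube(2) by (intro nn_integral_cmult borel_measurable_nn_integral_count_space count)
      (auto intro!: borel_measurable_times_ennreal borel_measurable_indicator)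
  also have "(\<integral>\<^sup>+x. (\<integral>\<^sup>+i. ?\<phi> (snd i) * indicator (snd i) x \<partial>count_space ?I) \<partial>lebesgue)
      = (\<integral>\<^sup>+i. (\<integral>\<^sup>+x. ?\<phi> (snd i) * indicator (snd i) x \<partial>lebesgue) \<partial>count_space ?I)"
    using cube(2) by (intro nn_integral_count_space_nn_integral count)
      (auto intro!: borel_measurable_times_ennreal borel_measurable_indicator)
  also have "\<dots> = (\<integral>\<^sup>+i. average (snd i) ?f * average (snd i) ?g * emeasure lebesgue (snd i) \<partial>count_space ?I)"
    using cube(2) by (intro nn_integral_cong) (simp add: nn_integral_cmult_indicator average_product_def)
  also have "\<dots> = (\<integral>\<^sup>+x. sparse_op UNIV S f x * ennreal (g x) \<partial>lebesgue)"
    by (rule nn_integral_sparse_op_times[OF D S, symmetric]) measurable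
  finally show thesis
    using that[OF S] by blast
qed

text \<open>A finite infimum of admissible constants is itself admissible. If the norm of
  \<open>f\<close> is positive, division by it reduces this to a lower bound for the infimum. If it
  is zero, finiteness provides some admissible constant, and this one forces the left-hand side to
  vanish.\<close>

lemma Lp_norm_sparse_op_le:
  fixes u v :: "real^'n::finite \<Rightarrow> real"
  assumes X: "sparse_op_norm p v u K S < \<infinity>"
    and f: "f \<in> borel_measurable lebesgue" "\<And>x. 0 \<le> f x"
      "Lp_norm p (\<lambda>x. ennreal (v x)) (\<lambda>x. ennreal (f x)) < \<infinity>"
  shows "Lp_norm p (\<lambda>x. ennreal (u x)) (sparse_op K S f)
    \<le> sparse_op_norm p v u K S * Lp_norm p (\<lambda>x. ennreal (v x)) (\<lambda>x. ennreal (f x))"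
proof -
  let ?F = "\<lambda>f. Lp_norm p (\<lambda>x. ennreal (v x)) (\<lambda>x. ennreal (f x))"
  let ?L = "\<lambda>f. Lp_norm p (\<lambda>x. ennreal (u x)) (sparse_op K S f)"
  let ?C = "{C :: ennreal. \<forall>f \<in> borel_measurable lebesgue. (\<forall>x. 0 \<le> f x) \<and> ?F f < \<infinity> \<longrightarrow> ?L f \<le> C * ?F f}"
  have C: "?L f \<le> C * ?F f" if "C \<in> ?C" for C
    using that f by blast
  show ?thesis
  proof (cases "?F f = 0")
    case True
    have "?C \<noteq> {}"
    proof
      assume "?C = {}"
      then have "sparse_op_norm p v u K S = top"
        unfolding sparse_op_norm_def by (simp only: Inf_empty)
      then show False
        using X by simp
    qed
    then obtain C where "C \<in> ?C"
      by blast
    from C[OF this] show ?thesis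
      by (simp add: True)
  next
    case False
    have "?L f / ?F f \<le> sparse_op_norm p v u K S"
      unfolding sparse_op_norm_def
    proof (rule Inf_greatest)
      fix C assume "C \<in> ?C"
      from C[OF this] show "?L f / ?F f \<le> C"
        using False by (intro divide_le_posI_ennreal) (auto simp: zero_less_iff_neq_zero mult.commute)
    qed
    then have "?L f / ?F f * ?F f \<le> sparse_op_norm p v u K S * ?F f"
      by (rule mult_right_mono) simp
    moreover have "?L f / ?F f * ?F f = ?L f"
      using False f(3) by (subst ennreal_divide_times) (simp add: ennreal_divide_self)
    ultimately show ?thesis
      by simp
  qed
qed

section \<open>Passage from truncated to arbitrary functions\<close>

lemma SUP_mult_SUP_mono:
  fixes a b :: "nat \<Rightarrow> ennreal"
  assumes "mono a" "mono b"
  shows "(SUP n. a n) * (SUP n. b n) = (SUP n. a n * b n)"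
proof (rule antisym)
  have "a m * b n \<le> (SUP n. a n * b n)" for m n
  proof -
    have "a m * b n \<le> a (max m n) * b (max m n)"
      using assms by (intro mult_mono) (auto simp: mono_def)
    also have "\<dots> \<le> (SUP n. a n * b n)"
      by (rule SUP_upper) simp
    finally show ?thesis .
  qed
  then show "(SUP n. a n) * (SUP n. b n) \<le> (SUP n. a n * b n)"
    by (simp add: SUP_mult_left_ennreal SUP_mult_right_ennreal) (auto intro!: SUP_least)
  show "(SUP n. a n * b n) \<le> (SUP n. a n) * (SUP n. b n)"
    by (intro SUP_least mult_mono SUP_upper) auto
qed

lemma average_mono: "(\<And>x. f x \<le> g x) \<Longrightarrow> average Q f \<le> average Q g"
  unfolding average_def by (intro divide_right_mono_ennreal nn_integral_mono mult_right_mono) auto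

lemma average_SUP_trunc:
  fixes h :: "real^'n::finite \<Rightarrow> ennreal"
  assumes [measurable]: "h \<in> borel_measurable lebesgue" and "cube Q"
  shows "average Q h = (SUP N. average Q (trunc N h))"
proof -
  have [measurable]: "Q \<in> sets lebesgue"
    by (rule cube_in_sets_lebesgue[OF assms(2)])
  have "(\<integral>\<^sup>+x\<in>Q. h x \<partial>lebesgue) = (\<integral>\<^sup>+x. (SUP N. trunc N h x * indicator Q x) \<partial>lebesgue)"
    by (intro nn_integral_cong) (simp add: SUP_trunc flip: SUP_mult_right_ennreal)
  also have "\<dots> = (SUP N. \<integral>\<^sup>+x\<in>Q. trunc N h x \<partial>lebesgue)"
    by (intro nn_integral_monotone_convergence_SUP)
      (auto intro!: incseq_SucI le_funI mult_right_mono trunc_mono)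
  finally show ?thesis
    unfolding average_def by (simp add: divide_ennreal_def SUP_mult_right_ennreal)
qed

text \<open>The indicator in \<open>grid_maximal\<close> replaces the condition that
  \<open>x\<close> lie in the cube, so the supremum runs over one countable set for all
  \<open>x\<close>.\<close>

lemma measurable_grid_maximal:
  assumes "dyadic_grid D"
  shows "grid_maximal D f g \<in> borel_measurable lebesgue"
proof -
  have "Q \<in> sets lebesgue" if "Q \<in> D" for Q
    by (rule cube_in_sets_lebesgue[OF dyadic_grid_cube[OF assms that]])
  then show ?thesis
    unfolding grid_maximal_def[abs_def]
    by (intro borel_measurable_SUP countable_dyadic_grid[OF assms])
      (auto intro!: borel_measurable_times_ennreal borel_measurable_indicator)
qed

lemma grid_maximal_mono:
  "(\<And>x. f x \<le> f' x) \<Longrightarrow> (\<And>x. g x \<le> g' x) \<Longrightarrow> grid_maximal D f g x \<le> grid_maximal D f' g' x"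
  unfolding grid_maximal_def by (intro SUP_mono' mult_right_mono mult_mono average_mono) auto

text \<open>For a single cube, monotone convergence applies to both averages and the product of the
  two increasing sequences is taken along the diagonal; the suprema over cubes and over truncations
  then commute.\<close>

lemma grid_maximal_SUP_trunc:
  fixes f g :: "real^'n::finite \<Rightarrow> ennreal"
  assumes "dyadic_grid D" "f \<in> borel_measurable lebesgue" "g \<in> borel_measurable lebesgue"
  shows "grid_maximal D f g x = (SUP N. grid_maximal D (trunc N f) (trunc N g) x)"
proof -
  have "grid_maximal D f g x =
      (SUP Q\<in>D. SUP N. average Q (trunc N f) * average Q (trunc N g) * indicator Q x)"
    unfolding grid_maximal_def
  proof (rule SUP_cong[OF refl])
    fix Q assume "Q \<in> D"
    then have "cube Q"
      by (rule dyadic_grid_cube[OF assms(1)])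
    then have "average Q f * average Q g = (SUP N. average Q (trunc N f) * average Q (trunc N g))"
      unfolding average_SUP_trunc[OF assms(2) \<open>cube Q\<close>] average_SUP_trunc[OF assms(3) \<open>cube Q\<close>]
      by (intro SUP_mult_SUP_mono monoI average_mono trunc_mono)
    then show "average Q f * average Q g * indicator Q x
        = (SUP N. average Q (trunc N f) * average Q (trunc N g) * indicator Q x)"
      by (simp add: SUP_mult_right_ennreal)
  qed
  also have "\<dots> = (SUP N. grid_maximal D (trunc N f) (trunc N g) x)"
    unfolding grid_maximal_def by (rule SUP_commute)
  finally show ?thesis .
qed

lemma nn_integral_trunc_finite:
  fixes h :: "'a::euclidean_space \<Rightarrow> ennreal"
  shows "(\<integral>\<^sup>+x. trunc N h x \<partial>lebesgue) < \<infinity>"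
proof -
  have "(\<integral>\<^sup>+x. trunc N h x \<partial>lebesgue) \<le> (\<integral>\<^sup>+x. of_nat N * indicator (cball 0 (real N)) x \<partial>(lebesgue :: 'a measure))"
    unfolding trunc_def by (intro nn_integral_mono mult_right_mono) auto
  also have "\<dots> = of_nat N * emeasure lebesgue (cball (0::'a) (real N))"
    by (rule nn_integral_cmult_indicator) simp
  also have "\<dots> < \<infinity>"
    using emeasure_bounded_finite[of "cball (0::'a) (real N)"]
    by (simp add: ennreal_mult_less_top of_nat_less_top emeasure_completion)
  finally show ?thesis .
qed

text \<open>Each truncation has its own sparse family, but \<open>X\<close> bounds the norms of all
  of them, so the estimate is uniform in \<open>N\<close> and survives monotone convergence.\<close>

lemma nn_integral_grid_maximal_le:
  fixes u v :: "real^'n::finite \<Rightarrow> real" and f g :: "real^'n \<Rightarrow> ennreal"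
  assumes p: "1 < p" "p' = p / (p - 1)" and u: "weight u" and D: "dyadic_grid D"
    and X: "\<And>S. sparse_family D UNIV S \<Longrightarrow> sparse_op_norm p v u UNIV S \<le> X" "X < \<infinity>"
    and meas: "f \<in> borel_measurable lebesgue" "g \<in> borel_measurable lebesgue"
    and f: "Lp_norm p (\<lambda>x. ennreal (v x)) f < \<infinity>"
    and g: "Lp_norm p' (\<lambda>x. epowr (ennreal (u x)) (1 - p')) g < \<infinity>"
  shows "(\<integral>\<^sup>+x. grid_maximal D f g x \<partial>lebesgue) \<le> ennreal (4 ^ (CARD('n) + 1)) *
    (X * (Lp_norm p (\<lambda>x. ennreal (v x)) f * Lp_norm p' (\<lambda>x. epowr (ennreal (u x)) (1 - p')) g))"
    (is "_ \<le> ?a * (X * (?F f * ?G g))")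
proof -
  note conj = conjugate_exponent[OF p]
  have pos: "0 < p" "0 < p'"
    using p conj by auto
  have bound: "(\<integral>\<^sup>+x. grid_maximal D (trunc N f) (trunc N g) x \<partial>lebesgue) \<le> ?a * (X * (?F f * ?G g))" for N
  proof -
    define f' g' where "f' x = enn2real (trunc N f x)" and "g' x = enn2real (trunc N g x)" for x
    have f': "(\<lambda>x. ennreal (f' x)) = trunc N f" and g': "(\<lambda>x. ennreal (g' x)) = trunc N g"
      using trunc_less_top[of N f] trunc_less_top[of N g] by (auto simp: f'_def g'_def)
    have [measurable]: "f' \<in> borel_measurable lebesgue" "g' \<in> borel_measurable lebesgue"
      unfolding f'_def[abs_def] g'_def[abs_def] using meas by measurable
    have nonneg: "0 \<le> f' x" "0 \<le> g' x" for x
      by (simp_all add: f'_def g'_def)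
    have "enn2real (trunc N h x) \<le> real N" for h and x :: "real^'n"
      using enn2real_mono[OF trunc_le_of_nat[of N h x]] by (simp add: of_nat_less_top)
    then have bdd: "f' x \<le> real N" "g' x \<le> real N" for x
      by (simp_all add: f'_def g'_def)
    have F: "?F (trunc N f) \<le> ?F f" and G: "?G (trunc N g) \<le> ?G g"
      using pos by (auto intro!: Lp_norm_mono trunc_le)
    obtain S where S: "sparse_family D UNIV S" and
      le: "(\<integral>\<^sup>+x. grid_maximal D (trunc N f) (trunc N g) x \<partial>lebesgue)
        \<le> ?a * (\<integral>\<^sup>+x. sparse_op UNIV S f' x * ennreal (g' x) \<partial>lebesgue)"
      by (rule nn_integral_grid_maximal_le_sparse_op[OF D, of f' g' "real N"])
        (auto simp: f' g' nn_integral_trunc_finite[unfolded infinity_ennreal_def] bdd)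
    have norm: "sparse_op_norm p v u UNIV S \<le> X"
      by (rule X(1)[OF S])
    have "?F (\<lambda>x. ennreal (f' x)) < \<infinity>"
      unfolding f' using F f by (rule le_less_trans)
    then have "Lp_norm p (\<lambda>x. ennreal (u x)) (sparse_op UNIV S f')
        \<le> sparse_op_norm p v u UNIV S * ?F (\<lambda>x. ennreal (f' x))"
      using norm X(2) nonneg by (intro Lp_norm_sparse_op_le) (auto intro: le_less_trans)
    also have "\<dots> \<le> X * ?F f"
      unfolding f' by (intro mult_mono norm F) auto
    finally have A: "Lp_norm p (\<lambda>x. ennreal (u x)) (sparse_op UNIV S f') \<le> X * ?F f" .
    \<comment> \<open>Hoelder's inequality is available only for finite norms; this is where
      finiteness of \<open>X\<close> is used.\<close>
    have A_fin: "Lp_norm p (\<lambda>x. ennreal (u x)) (sparse_op UNIV S f') < \<infinity>"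
      using A by (rule le_less_trans) (use X(2) f in \<open>simp add: ennreal_mult_less_top\<close>)
    have G_fin: "?G (\<lambda>x. ennreal (g' x)) < \<infinity>"
      unfolding g' using G g by (rule le_less_trans)
    have "(\<integral>\<^sup>+x. sparse_op UNIV S f' x * ennreal (g' x) \<partial>lebesgue)
        \<le> Lp_norm p (\<lambda>x. ennreal (u x)) (sparse_op UNIV S f') * ?G (\<lambda>x. ennreal (g' x))"
      using u nonneg A_fin G_fin
      by (intro Holder_inequality_weighted[OF p measurable_weight[OF u]] measurable_sparse_op[OF D S])
        (auto simp: weight_def)
    also have "\<dots> \<le> (X * ?F f) * ?G g"
      unfolding g' by (intro mult_mono A G) auto
    finally have "?a * (\<integral>\<^sup>+x. sparse_op UNIV S f' x * ennreal (g' x) \<partial>lebesgue) \<le> ?a * (X * (?F f * ?G g))"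
      unfolding mult.assoc by (rule mult_left_mono) simp
    with le show ?thesis
      by (rule order_trans)
  qed
  have "(\<integral>\<^sup>+x. grid_maximal D f g x \<partial>lebesgue)
      = (\<integral>\<^sup>+x. (SUP N. grid_maximal D (trunc N f) (trunc N g) x) \<partial>lebesgue)"
    using grid_maximal_SUP_trunc[OF D meas] by simp
  also have "\<dots> = (SUP N. \<integral>\<^sup>+x. grid_maximal D (trunc N f) (trunc N g) x \<partial>lebesgue)"
    by (intro nn_integral_monotone_convergence_SUP measurable_grid_maximal D incseq_SucI le_funI
        grid_maximal_mono trunc_mono) auto
  also have "\<dots> \<le> ?a * (X * (?F f * ?G g))"
    by (intro SUP_least bound)
  finally show ?thesis .
qed

text \<open>The constant collects 36^n from enlarging cubes to grid cubes, 2^n from the number of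
  grids, and 4^(n+1) from sparse domination in each grid. For infinite \<open>X\<close> the
  right-hand side is infinite because this constant is positive.\<close>

lemma bilinear_maximal_norm_le:
  fixes u v :: "real^'n::finite \<Rightarrow> real"
  assumes p: "1 < p" "p' = p / (p - 1)" and u: "weight u"
    and X: "\<And>(D :: (real^'n) set set) S. dyadic_grid D \<Longrightarrow> sparse_family D UNIV S \<Longrightarrow> sparse_op_norm p v u UNIV S \<le> X"
  shows "bilinear_maximal_norm p v p' u \<le>
    ennreal (36 ^ CARD('n) * (2 ^ CARD('n) * 4 ^ (CARD('n) + 1))) * X"
proof (cases "X = \<infinity>")
  case True
  then show ?thesis
    by (simp add: ennreal_mult_top)
next
  case False
  then have "X < \<infinity>"
    by (simp add: top.not_eq_extremum)
  show ?thesis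
    unfolding bilinear_maximal_norm_def
  proof (rule Inf_lower, clarify)
    fix f g :: "real^'n \<Rightarrow> real"
    let ?f = "\<lambda>x. ennreal \<bar>f x\<bar>" and ?g = "\<lambda>x. ennreal \<bar>g x\<bar>"
    let ?F = "Lp_norm p (\<lambda>x. ennreal (v x)) ?f"
    let ?G = "Lp_norm p' (\<lambda>x. epowr (ennreal (u x)) (1 - p')) ?g"
    let ?n = "CARD('n)"
    assume [measurable]: "f \<in> borel_measurable lebesgue" "g \<in> borel_measurable lebesgue"
      and fin: "?F < \<infinity>" "?G < \<infinity>"
    let ?M = "\<lambda>\<tau>. grid_maximal (shifted_grid \<tau>) ?f ?g"
    have M[measurable]: "?M \<tau> \<in> borel_measurable lebesgue" for \<tau>
      by (rule measurable_grid_maximal[OF dyadic_grid_shifted_grid])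
    have "(\<integral>\<^sup>+x. bilinear_maximal f g x \<partial>lebesgue)
        \<le> (\<integral>\<^sup>+x. ennreal (36 ^ ?n) * (\<Sum>\<tau>\<in>UNIV. ?M \<tau> x) \<partial>lebesgue)"
      by (intro nn_integral_mono bilinear_maximal_le_sum_grid_maximal)
    also have "\<dots> = ennreal (36 ^ ?n) * (\<Sum>\<tau>\<in>UNIV. \<integral>\<^sup>+x. ?M \<tau> x \<partial>lebesgue)"
      by (simp add: nn_integral_cmult nn_integral_sum)
    also have "(\<Sum>\<tau>\<in>UNIV. \<integral>\<^sup>+x. ?M \<tau> x \<partial>lebesgue)
        \<le> (\<Sum>\<tau>\<in>(UNIV :: ('n \<Rightarrow> bool) set). ennreal (4 ^ (?n + 1)) * (X * (?F * ?G)))"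
      using fin \<open>X < \<infinity>\<close> X[OF dyadic_grid_shifted_grid]
      by (intro sum_mono nn_integral_grid_maximal_le[OF p u dyadic_grid_shifted_grid]) auto
    also have "\<dots> = ennreal (2 ^ ?n) * (ennreal (4 ^ (?n + 1)) * (X * (?F * ?G)))"
      by (simp add: card_fun flip: ennreal_power)
    finally have "(\<integral>\<^sup>+x. bilinear_maximal f g x \<partial>lebesgue)
        \<le> ennreal (36 ^ ?n) * (ennreal (2 ^ ?n) * (ennreal (4 ^ (?n + 1)) * (X * (?F * ?G))))"
      by (simp add: mult_left_mono)
    also have "\<dots> = ennreal (36 ^ ?n * (2 ^ ?n * 4 ^ (?n + 1))) * X * (?F * ?G)"
      by (simp only: ennreal_mult mult.assoc zero_le_power zero_le_numeral mult_nonneg_nonneg)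
    finally show "(\<integral>\<^sup>+x. bilinear_maximal f g x \<partial>lebesgue)
        \<le> ennreal (36 ^ ?n * (2 ^ ?n * 4 ^ (?n + 1))) * X * (?F * ?G)" .
  qed
qed

theorem theorem1p2:
  shows "\<exists>C :: real. C > 0 \<and>
    (\<forall>(p :: real) (p' :: real) (u :: real^'n::finite \<Rightarrow> real) (v :: real^'n \<Rightarrow> real).
      1 < p \<and> p' = p / (p - 1) \<and> weight u \<and> weight v \<longrightarrow>
      (SUP (D, K, S) \<in> {(D, K, S). dyadic_grid D \<and> sparse_family D K S}. sparse_op_norm p v u K S)
        \<le> ennreal C * bilinear_maximal_norm p v p' u \<and>
      bilinear_maximal_norm p v p' u
        \<le> ennreal C *
          (SUP (D, K, S) \<in> {(D, K, S). dyadic_grid D \<and> sparse_family D K S}. sparse_op_norm p v u K S))"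
proof (intro exI conjI allI impI; (elim conjE)?)
  let ?C = "36 ^ CARD('n) * (2 ^ CARD('n) * 4 ^ (CARD('n) + 1)) :: real"
  show "0 < ?C"
    by simp
  fix p p' :: real and u v :: "real^'n \<Rightarrow> real"
  assume p: "1 < p" "p' = p / (p - 1)" and u: "weight u"
  \<comment> \<open>A single constant serves both inequalities, so it must also dominate the factor
    2 of the bound of the sparse operators by the maximal one.\<close>
  have "2 \<le> ?C"
  proof -
    have "(4::real) \<le> 4 ^ (CARD('n) + 1)"
      using one_le_power[of "4::real" "CARD('n)"] by simp
    then have "1 * (1 * 4) \<le> ?C"
      by (intro mult_mono one_le_power) auto
    then show ?thesis
      by (rule order_trans[rotated]) simp
  qed
  then have "2 \<le> ennreal ?C"
    using ennreal_leI[of 2 ?C] by simp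
  show "(SUP (D, K, S) \<in> {(D, K, S). dyadic_grid D \<and> sparse_family D K S}. sparse_op_norm p v u K S)
      \<le> ennreal ?C * bilinear_maximal_norm p v p' u"
  proof (rule SUP_least, clarify)
    fix D :: "(real^'n) set set" and K S assume S: "dyadic_grid D" "sparse_family D K S"
    have "sparse_op_norm p v u K S \<le> 2 * bilinear_maximal_norm p v p' u"
      by (rule sparse_op_norm_le[OF p u S])
    also have "\<dots> \<le> ennreal ?C * bilinear_maximal_norm p v p' u"
      by (rule mult_right_mono) (use \<open>2 \<le> ennreal ?C\<close> in auto)
    finally show "sparse_op_norm p v u K S \<le> ennreal ?C * bilinear_maximal_norm p v p' u" .
  qed
  show "bilinear_maximal_norm p v p' u \<le> ennreal ?C *
      (SUP (D, K, S) \<in> {(D, K, S). dyadic_grid D \<and> sparse_family D K S}. sparse_op_norm p v u K S)"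
  proof (rule bilinear_maximal_norm_le[OF p u])
    fix D :: "(real^'n) set set" and S assume "dyadic_grid D" "sparse_family D UNIV S"
    then show "sparse_op_norm p v u UNIV S \<le>
        (SUP (D, K, S) \<in> {(D, K, S). dyadic_grid D \<and> sparse_family D K S}. sparse_op_norm p v u K S)"
      by (intro SUP_upper2[of "(D, UNIV, S)"]) auto
  qed
qed

end
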